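(* Let $K$ be a field and $d\geq 1$, $m\geq 1$ integers. Let $$A=\{\text{strongly stable monomial ideals of } K[x_0,\ldots,x_m] \text{ generated in degree } d\}$$ and $$B=\{\text{strongly stable monomial ideals of } K[y_1,\ldots,y_d] \text{ with height } d \text{ and generated in degrees}\leq m+1\}.$$ Then the assignment $V\mapsto\psi(V^c)$ establishes a one-to-one correspondence between $A$ and $B$.
   Context: $\mathbb{N}=\{0,1,2,\ldots\}$. A monomial ideal $I$ of $K[x_0,\ldots,x_m]$ is strongly stable if for every monomial $u\in I$, every $j$ such that $x_j$ divides $u$, and every $i<j$, one has $(u/x_j)\cdot x_i\in I$; similarly for ideals of $K[y_1,\ldots,y_d]$ (a variable $y_j$ dividing a monomial may be replaced by $y_i$ with $i<j$). Let $S=K[x_i:i\in\mathbb{N}]$ with the standard grading and $S_d$ its degree $d$ component. An ideal in $A$ is identified with the monomial space $V\subset K[x_0,\ldots,x_m]_d\subset S_d$ spanned by its degree $d$ monomials. $V^c$ is the $K$-span of all the monomials of $S_d$ which are not in $V$. The map $\psi:S_d\to K[y_1,\ldots,y_d]$ is the isomorphism of $K$-vector spaces sending monomials to monomials by $$\psi(x_0^{a_0}x_1^{a_1}\cdots x_e^{a_e})=y_{a_0+1}y_{a_0+a_1+1}\cdots y_{a_0+\cdots+a_{e-1}+1}\qquad(a_e>0,\ a_0+\cdots+a_e=d),$$ with $\psi(x_0^d)=1$; it is the inverse of $y_1^{b_1}\cdots y_d^{b_d}\mapsto x_{b_1}x_{b_1+b_2}\cdots x_{b_1+\cdots+b_d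}$.
   Formalization: The set A is taken to consist of nonzero ideals: the zero ideal would correspond to the unit ideal of K[y_1,…,y_d], which does not have height d. *)

theory Defs
  imports "HOL-Library.Poly_Mapping" "HOL-Library.Extended_Nat" "HOL-Algebra.Ideal" Complex_Main
begin

text \<open>A monomial is identified with its exponent vector. Every polynomial ring below is a subring of
  \<open>K[z\<^sub>i : i \<in> \<nat>]\<close>, the monoid algebra of the exponent vectors over the field \<open>'k\<close>; both the
  variables \<open>x\<^sub>i\<close> and the variables \<open>y\<^sub>i\<close> are modelled by the index \<open>i\<close>.\<close>

type_synonym expo = "nat \<Rightarrow>\<^sub>0 nat"
type_synonym 'k mpoly = "expo \<Rightarrow>\<^sub>0 'k"

definition monomial :: "expo \<Rightarrow> 'k::field mpoly"
  where "monomial t = Poly_Mapping.single t 1"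

definition mdeg :: "expo \<Rightarrow> nat"
  where "mdeg t = (\<Sum>i\<in>Poly_Mapping.keys t. Poly_Mapping.lookup t i)"

definition homogeneous :: "nat \<Rightarrow> 'k::field mpoly \<Rightarrow> bool"
  where "homogeneous n p \<longleftrightarrow> (\<forall>t\<in>Poly_Mapping.keys p. mdeg t = n)"

definition poly_ring :: "nat set \<Rightarrow> 'k::field mpoly ring"
  where "poly_ring X =
    \<lparr>carrier = {p. \<forall>t\<in>Poly_Mapping.keys p. Poly_Mapping.keys t \<subseteq> X},
      mult = (*), one = 1, zero = 0, add = (+)\<rparr>"

definition monomial_ideal :: "nat set \<Rightarrow> 'k::field mpoly set \<Rightarrow> bool"
  where "monomial_ideal X I \<longleftrightarrow> ideal I (poly_ring X) \<and>
    (\<exists>T \<subseteq> {t. Poly_Mapping.keys t \<subseteq> X}. I = Idl\<^bsub>poly_ring X\<^esub> (monomial ` T))"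

definition strongly_stable :: "nat set \<Rightarrow> 'k::field mpoly set \<Rightarrow> bool"
  where "strongly_stable X I \<longleftrightarrow>
    (\<forall>t i j. monomial t \<in> I \<and> i \<in> X \<and> j \<in> X \<and> Poly_Mapping.lookup t j > 0 \<and> i < j \<longrightarrow>
      monomial (t - Poly_Mapping.single j 1 + Poly_Mapping.single i 1) \<in> I)"

definition generated_in_degrees :: "nat set \<Rightarrow> nat set \<Rightarrow> 'k::field mpoly set \<Rightarrow> bool"
  where "generated_in_degrees X D I \<longleftrightarrow>
    (\<exists>G \<subseteq> carrier (poly_ring X). (\<forall>g\<in>G. \<exists>n\<in>D. homogeneous n g) \<and> I = Idl\<^bsub>poly_ring X\<^esub> G)"

definition prime_height :: "('a, 'b) ring_scheme \<Rightarrow> 'a set \<Rightarrow> enat"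
  where "prime_height R P =
    Sup {enat n | n. \<exists>c :: nat \<Rightarrow> 'a set.
      (\<forall>i\<le>n. primeideal (c i) R) \<and> (\<forall>i<n. c i \<subset> c (Suc i)) \<and> c n = P}"

text \<open>The unit ideal lies in no prime ideal, so its height is \<open>\<infinity>\<close>, the infimum of the empty set.\<close>

definition ideal_height :: "('a, 'b) ring_scheme \<Rightarrow> 'a set \<Rightarrow> enat"
  where "ideal_height R I = Inf {prime_height R P | P. primeideal P R \<and> I \<subseteq> P}"

definition kscale :: "'k::field \<Rightarrow> 'k mpoly \<Rightarrow> 'k mpoly"
  where "kscale c p = Poly_Mapping.single 0 c * p"

global_interpretation kspace: vector_space "kscale :: 'k::field \<Rightarrow> 'k mpoly \<Rightarrow> 'k mpoly"
  by unfold_locales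
    (simp_all add: kscale_def distrib_left distrib_right single_add mult_single
      flip: mult.assoc single_one)

definition degree_space :: "nat \<Rightarrow> 'k::field mpoly set \<Rightarrow> 'k mpoly set"
  where "degree_space d I = kspace.span {monomial t | t. mdeg t = d \<and> monomial t \<in> I}"

text \<open>The complement is taken in the degree \<open>d\<close> component of the ring in all variables \<open>x\<^sub>i\<close>,
  \<open>i \<in> \<nat>\<close>, so it is infinite-dimensional even when \<open>V\<close> lives in finitely many variables.\<close>

definition monomial_compl :: "nat \<Rightarrow> 'k::field mpoly set \<Rightarrow> 'k mpoly set"
  where "monomial_compl d V = kspace.span {monomial t | t. mdeg t = d \<and> monomial t \<notin> V}"

text \<open>With \<open>e = Max (keys a)\<close> the last index occurring in \<open>a \<noteq> 0\<close>, the image of the monomial \<open>a\<close> is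
  the product of the \<open>y\<^sub>k\<close>, \<open>k = a\<^sub>0 + \<dots> + a\<^sub>i + 1\<close>, over \<open>i < e\<close>. Only exponents of degree
  \<open>d \<ge> 1\<close> matter; the value at \<open>a = 0\<close> is irrelevant.\<close>

definition psi_expo :: "expo \<Rightarrow> expo"
  where "psi_expo a = (\<Sum>i<Max (Poly_Mapping.keys a).
    Poly_Mapping.single ((\<Sum>j\<le>i. Poly_Mapping.lookup a j) + 1) 1)"

definition psi :: "'k::field mpoly \<Rightarrow> 'k mpoly"
  where "psi p = (\<Sum>a\<in>Poly_Mapping.keys p. kscale (Poly_Mapping.lookup p a) (monomial (psi_expo a)))"

text \<open>In \<open>ideals_A\<close> the zero ideal is excluded: it would correspond to the unit ideal, which
  does not have height \<open>d\<close>.\<close>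

definition ideals_A :: "nat \<Rightarrow> nat \<Rightarrow> 'k::field mpoly set set"
  where "ideals_A m d =
    {I. monomial_ideal {0..m} I \<and> strongly_stable {0..m} I \<and> I \<noteq> {0} \<and>
        generated_in_degrees {0..m} {d} I}"

definition ideals_B :: "nat \<Rightarrow> nat \<Rightarrow> 'k::field mpoly set set"
  where "ideals_B m d =
    {J. monomial_ideal {1..d} J \<and> strongly_stable {1..d} J \<and>
        ideal_height (poly_ring {1..d}) J = enat d \<and>
        generated_in_degrees {1..d} {..m + 1} J}"

end

theory Submission
  imports Defs
begin

text \<open>
  Why the correspondence holds. A monomial of degree \<open>d\<close> in the \<open>x\<^sub>i\<close> is a sorted list of indices
  \<open>c\<^sub>1 \<le> \<dots> \<le> c\<^sub>d\<close>, and \<open>\<psi>\<close> sends it to the monomial in \<open>y\<^sub>1, \<dots>, y\<^sub>d\<close> whose exponents are the gaps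
  \<open>c\<^sub>k - c\<^sub>k\<^sub>-\<^sub>1\<close>. Strong stability on the \<open>x\<close> side says that a set of monomials is closed under
  lowering the \<open>c\<^sub>k\<close>. On the \<open>y\<close> side, multiplying by \<open>y\<^sub>d\<close> raises \<open>c\<^sub>d\<close>, multiplying by \<open>y\<^sub>k\<close> raises
  \<open>c\<^sub>k, \<dots>, c\<^sub>d\<close>, and replacing \<open>y\<^sub>j\<close> by \<open>y\<^sub>i\<close> with \<open>i < j\<close> raises \<open>c\<^sub>i, \<dots>, c\<^sub>j\<^sub>-\<^sub>1\<close>; so the monomials of a
  strongly stable ideal are the sets closed under raising the \<open>c\<^sub>k\<close>. Complementation exchanges the
  two closure properties.

  The bound \<open>c\<^sub>d \<le> m\<close> (only \<open>x\<^sub>0, \<dots>, x\<^sub>m\<close> occur in the given set) becomes, on the complement, that all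
  monomials of degree at least \<open>m + 1\<close> in the \<open>y\<^sub>k\<close> belong to the ideal. For a strongly stable ideal
  this is equivalent to being generated in degrees at most \<open>m + 1\<close> and containing a power of \<open>y\<^sub>d\<close>.
  Nonzero ideals correspond to proper ones, because \<open>x\<^sub>0\<^sup>d\<close>, which lies in every nonempty strongly
  stable set of degree \<open>d\<close>, maps to \<open>1\<close>. This is the combinatorial bijection \<open>bij_betw_psi_compl\<close>,
  which rests on the Galois connection \<open>psi_expo_galois\<close> and on the description of strongly stable
  sets by dominance of partial sums in \<open>stable_expos_dominance\<close>.

  It remains to see that a strongly stable monomial ideal of \<open>K[y\<^sub>1, \<dots>, y\<^sub>d]\<close> has height \<open>d\<close> exactly
  when it is proper and contains a power of \<open>y\<^sub>d\<close> (\<open>ideal_height_eq_iff\<close>). If it does, strong stability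
  yields powers of all variables, so \<open>(y\<^sub>1, \<dots>, y\<^sub>d)\<close> is the only prime above it. If it contains no
  power of \<open>y\<^sub>d\<close>, it lies in \<open>(y\<^sub>1, \<dots>, y\<^sub>d\<^sub>-\<^sub>1)\<close>, whose height is smaller than \<open>d\<close>; the unit ideal
  has infinite height. The first two cases need that
  a chain of primes in \<open>K[y\<^sub>1, \<dots>, y\<^sub>d]\<close> has length at most \<open>d\<close> (\<open>prime_chain_length_le\<close>). The argument
  for this is elementary: elements \<open>x\<^sub>i \<in> P\<^sub>i\<^sub>+\<^sub>1 - P\<^sub>i\<close> picked along a chain are algebraically
  independent over \<open>K\<close>, whereas counting monomials shows that \<open>d + 1\<close> polynomials in \<open>d\<close> variables
  are algebraically dependent.
\<close>

section \<open>Partial sums of exponent vectors\<close>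

abbreviation (input) keys where "keys \<equiv> Poly_Mapping.keys"
abbreviation (input) lookup where "lookup \<equiv> Poly_Mapping.lookup"
abbreviation (input) single where "single \<equiv> Poly_Mapping.single"

definition psum :: "expo \<Rightarrow> nat \<Rightarrow> nat"
  where "psum t i = (\<Sum>j\<le>i. lookup t j)"

lemma psum_zero [simp]: "psum 0 i = 0"
  by (simp add: psum_def)

lemma psum_add: "psum (s + t) i = psum s i + psum t i"
  by (simp add: psum_def lookup_add sum.distrib)

lemma psum_single: "psum (single j n) i = (if j \<le> i then n else 0)"
  by (simp add: psum_def lookup_single when_def sum.delta)

lemma psum_sum: "psum (sum f A) i = (\<Sum>x\<in>A. psum (f x) i)"
  by (induction A rule: infinite_finite_induct) (simp_all add: psum_add)

lemma psum_mono: "i \<le> j \<Longrightarrow> psum t i \<le> psum t j"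
  unfolding psum_def by (rule sum_mono2) auto

lemma psum_Suc: "psum t (Suc i) = psum t i + lookup t (Suc i)"
  by (simp add: psum_def)

text \<open>Partial sums serve as coordinates on exponent vectors below: strong stability, multiplication
  and \<open>\<psi>\<close> all become pointwise statements about them.\<close>

lemma psum_inject:
  assumes "\<And>i. psum s i = psum t i"
  shows "s = t"
proof (rule poly_mapping_eqI)
  fix i show "lookup s i = lookup t i"
  proof (cases i)
    case 0 then show ?thesis using assms[of 0] by (simp add: psum_def)
  next
    case (Suc k) then show ?thesis using assms[of k] assms[of "Suc k"] by (simp add: psum_Suc)
  qed
qed

lemma psum_eq_mdeg:
  assumes "keys t \<subseteq> {..n}" shows "psum t n = mdeg t"
  unfolding psum_def mdeg_def using assms
  by (intro sum.mono_neutral_right) (auto simp: in_keys_iff)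

lemma psum_le_mdeg: "psum t n \<le> mdeg t"
proof -
  have "keys t \<subseteq> {..max n (Max (keys t))}" by (auto simp: le_max_iff_disj)
  then have "mdeg t = psum t (max n (Max (keys t)))" by (simp add: psum_eq_mdeg)
  then show ?thesis by (simp add: psum_mono)
qed

lemma keys_subset_iff_psum: "keys t \<subseteq> {..n} \<longleftrightarrow> psum t n = mdeg t"
proof
  assume eq: "psum t n = mdeg t"
  show "keys t \<subseteq> {..n}"
  proof
    fix j assume j: "j \<in> keys t"
    show "j \<in> {..n}"
    proof (rule ccontr)
      assume "j \<notin> {..n}"
      then obtain k where k: "j = Suc k" "n \<le> k" by (cases j) auto
      then have "psum t n < psum t j"
        using psum_mono[of n k t] j by (simp add: psum_Suc in_keys_iff)
      then show False using eq psum_le_mdeg[of t j] by simp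
    qed
  qed
qed (rule psum_eq_mdeg)

lemma keys_add_expo: "keys (s + t :: expo) = keys s \<union> keys t"
  by (auto simp: in_keys_iff lookup_add)

lemma mdeg_add: "mdeg (s + t) = mdeg s + mdeg t"
proof -
  define n where "n = Max (keys (s + t))"
  have "keys (s + t) \<subseteq> {..n}" by (auto simp: n_def)
  then have "psum (s + t) n = mdeg (s + t)" "psum s n = mdeg s" "psum t n = mdeg t"
    by (auto intro!: psum_eq_mdeg simp: keys_add_expo)
  then show ?thesis by (simp add: psum_add)
qed

lemma mdeg_single [simp]: "mdeg (single j n) = n"
  by (auto simp: mdeg_def)

lemma mdeg_eq_0_iff: "mdeg t = 0 \<longleftrightarrow> t = 0"
  by (auto simp: mdeg_def in_keys_iff intro!: poly_mapping_eqI)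

lemma expo_split_var:
  assumes "lookup t j > 0"
  shows "t = (t - single j 1) + single j (1::nat)"
  using assms by (intro poly_mapping_eqI) (auto simp: lookup_add lookup_minus lookup_single when_def)

section \<open>Strong stability as dominance\<close>

definition stable_expos :: "nat set \<Rightarrow> expo set \<Rightarrow> bool"
  where "stable_expos X V \<longleftrightarrow>
    (\<forall>t\<in>V. \<forall>i\<in>X. \<forall>j\<in>X. lookup t j > 0 \<longrightarrow> i < j \<longrightarrow> t - single j 1 + single i 1 \<in> V)"

definition upset_expos :: "nat set \<Rightarrow> expo set \<Rightarrow> bool"
  where "upset_expos X N \<longleftrightarrow>
    N \<subseteq> {t. keys t \<subseteq> X} \<and> (\<forall>t\<in>N. \<forall>r. keys r \<subseteq> X \<longrightarrow> t + r \<in> N)"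

lemma psum_move:
  assumes "lookup t j > 0" "i < j"
  shows "psum (t - single j 1 + single i 1) k = psum t k + (if i \<le> k \<and> k < j then 1 else 0)"
  using arg_cong[OF expo_split_var[OF assms(1)], of "\<lambda>t. psum t k"] assms(2)
  by (simp add: psum_add psum_single split: if_splits)

lemma mdeg_move:
  assumes "lookup t j > 0"
  shows "mdeg (t - single j 1 + single i 1) = mdeg t"
  using arg_cong[OF expo_split_var[OF assms(1)], of mdeg] by (simp add: mdeg_add)

lemma keys_move: "keys (t - single j 1 + single i 1 :: expo) \<subseteq> insert i (keys t)"
  by (auto simp: in_keys_iff lookup_add lookup_minus lookup_single when_def split: if_splits)

text \<open>The gap between the partial sums of two monomials of the same degree can be closed by replacing
  variables with variables of smaller index, one at a time: where the sums of \<open>s\<close> fall short at \<open>i\<close>, the next variable \<open>j > i\<close>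
  occurring in \<open>s\<close> is replaced by \<open>i\<close>. The sums of \<open>s\<close> are constant on \<open>[i, j)\<close> while those of \<open>t\<close>
  do not decrease, so the new sums still stay below those of \<open>t\<close>.\<close>

lemma stable_expos_dominance:
  assumes "stable_expos {p..q} V" "s \<in> V" "keys s \<subseteq> {p..q}" "keys t \<subseteq> {p..q}"
    and "mdeg s = mdeg t" "\<And>i. psum s i \<le> psum t i"
  shows "t \<in> V"
  using assms(2,3,5,6)
proof (induction "\<Sum>i\<le>q. psum t i - psum s i" arbitrary: s rule: less_induct)
  case less
  show ?case
  proof (cases "s = t")
    case False
    then obtain i where "psum s i \<noteq> psum t i" using psum_inject by blast
    then have i: "psum s i < psum t i" using less.prems(4)[of i] by simp
    have ks: "keys s \<subseteq> {..q}" and kt: "keys t \<subseteq> {..q}" using less.prems(2) assms(4) by auto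
    have "p \<le> i"
    proof (rule ccontr)
      assume "\<not> p \<le> i"
      then have "psum t i = 0" using assms(4) by (auto simp: psum_def in_keys_iff subset_iff)
      then show False using i by simp
    qed
    have iq: "i < q"
    proof (rule ccontr)
      assume "\<not> i < q"
      then have "keys s \<subseteq> {..i}" using ks by auto
      then show False using i psum_eq_mdeg[of s i] less.prems(3) psum_le_mdeg[of t i] by simp
    qed
    have "\<not> keys s \<subseteq> {..i}"
      unfolding keys_subset_iff_psum using i less.prems(3) psum_le_mdeg[of t i] by simp
    then have ex: "\<exists>j. i < j \<and> lookup s j > 0" by (auto simp: in_keys_iff not_le)
    define j where "j = (LEAST j. i < j \<and> lookup s j > 0)"
    have j: "i < j" "lookup s j > 0" using LeastI_ex[OF ex] by (auto simp: j_def)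
    have jleast: "lookup s k = 0" if "i < k" "k < j" for k
      using not_less_Least[of k "\<lambda>j. i < j \<and> lookup s j > 0"] that by (auto simp: j_def)
    have "j \<in> keys s" using j by (simp add: in_keys_iff)
    then have jq: "j \<in> {p..q}" using less.prems(2) by blast
    have const: "psum s k = psum s i" if "i \<le> k" "k < j" for k
      using that
    proof (induction k rule: dec_induct)
      case (step n) then show ?case using jleast[of "Suc n"] by (simp add: psum_Suc)
    qed simp
    define s' where "s' = s - single j 1 + single i 1"
    have ps': "psum s' k = psum s k + (if i \<le> k \<and> k < j then 1 else 0)" for k
      unfolding s'_def by (rule psum_move[OF j(2,1)])
    have le: "psum s' k \<le> psum t k" for k
      using less.prems(4)[of k] const[of k] i psum_mono[of i k t] by (auto simp: ps')
    show ?thesis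
    proof (rule less.hyps)
      show "(\<Sum>i\<le>q. psum t i - psum s' i) < (\<Sum>i\<le>q. psum t i - psum s i)"
        by (rule sum_strict_mono_ex1) (use i iq j in \<open>auto simp: ps' intro!: bexI[of _ i]\<close>)
      show "s' \<in> V"
        using assms(1) less.prems(1) j jq \<open>p \<le> i\<close> iq by (auto simp: stable_expos_def s'_def)
      show "keys s' \<subseteq> {p..q}"
        using keys_move[of s j i] less.prems(2) \<open>p \<le> i\<close> iq by (fastforce simp: s'_def)
      show "mdeg s' = mdeg t" using mdeg_move[OF j(2)] less.prems(3) by (simp add: s'_def)
    qed (rule le)
  qed (use less.prems in simp)
qed

text \<open>Multiplying by the last variable changes only the partial sums from \<open>q\<close> on; it levels the
  degrees and so reduces the claim to the homogeneous case.\<close>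

lemma stable_upset_dominance:
  assumes "upset_expos {p..q} N" "stable_expos {p..q} N" "s \<in> N" "keys t \<subseteq> {p..q}"
    and "p \<le> q" "\<And>i. psum s i \<le> psum t i"
  shows "t \<in> N"
proof -
  define s' where "s' = s + single q (mdeg t - mdeg s)"
  have ks: "keys s \<subseteq> {p..q}" using assms by (auto simp: upset_expos_def)
  then have q: "psum s n = mdeg s" "psum t n = mdeg t" if "q \<le> n" for n
    using assms(4) that by (auto intro!: psum_eq_mdeg)
  have le: "mdeg s \<le> mdeg t" using assms(6)[of q] q by simp
  show ?thesis
  proof (rule stable_expos_dominance[OF assms(2)])
    show "s' \<in> N" using assms(1,3,5) by (simp add: upset_expos_def s'_def)
    show "keys s' \<subseteq> {p..q}" using ks assms(5) by (auto simp: s'_def keys_add_expo split: if_splits)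
    show "mdeg s' = mdeg t" using le by (simp add: s'_def mdeg_add)
    show "psum s' i \<le> psum t i" for i
      using assms(6)[of i] q[of i] le by (auto simp: s'_def psum_add psum_single)
  qed (rule assms(4))
qed

section \<open>The bijection \<open>\<psi>\<close> on exponent vectors\<close>

lemma mem_down_closed_iff_less_card:
  assumes "finite A" "\<And>i j. j \<in> A \<Longrightarrow> i \<le> j \<Longrightarrow> i \<in> A"
  shows "(i::nat) \<in> A \<longleftrightarrow> i < card A"
proof
  assume "i \<in> A"
  then have "{..i} \<subseteq> A" using assms(2) by auto
  from card_mono[OF assms(1) this] show "i < card A" by simp
next
  assume lt: "i < card A"
  show "i \<in> A"
  proof (rule ccontr)
    assume "i \<notin> A"
    then have "A \<subseteq> {..<i}" using assms(2) by (auto simp: not_le[symmetric])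
    then show False using lt card_mono[of "{..<i}" A] by simp
  qed
qed

text \<open>The key to \<open>\<psi>\<close>. In terms of the sorted list \<open>c\<^sub>1 \<le> \<dots> \<le> c\<^sub>d\<close> of indices of the monomial \<open>a\<close>,
  the partial sum \<open>psum (psi_expo a) k\<close> is \<open>c\<^sub>k\<close>, the number of \<open>i\<close> with \<open>psum a i < k\<close>. As \<open>psum a\<close> is
  increasing, these \<open>i\<close> form an initial segment.\<close>

lemma psi_expo_galois:
  assumes "mdeg a = d" "k \<le> d"
  shows "psum a i < k \<longleftrightarrow> i < psum (psi_expo a) k"
proof -
  define e where "e = Max (keys a)"
  \<comment> \<open>the cut-off \<open>i < e\<close> in the definition of \<open>\<psi>\<close> is automatic, as the partial sums equal \<open>d\<close> from \<open>e\<close> on\<close>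
  have e: "psum a i < k \<Longrightarrow> i < e" for i
  proof (rule ccontr)
    assume h: "psum a i < k" "\<not> i < e"
    have "keys a \<subseteq> {..e}" by (auto simp: e_def)
    then have "psum a e = d" using assms by (simp add: psum_eq_mdeg)
    then show False using h psum_mono[of e i a] assms by simp
  qed
  have "psum (psi_expo a) k = (\<Sum>i<e. if psum a i < k then 1 else 0)"
    unfolding psi_expo_def psum_sum psum_single e_def[symmetric] psum_def[of a, symmetric]
    by (rule sum.cong) (auto simp: Suc_le_eq)
  also have "\<dots> = card {i. psum a i < k}"
    using e by (simp flip: sum.inter_filter) (metis lessThan_iff)
  finally have eq: "psum (psi_expo a) k = card {i. psum a i < k}" .
  have "i \<in> {i. psum a i < k} \<longleftrightarrow> i < card {i. psum a i < k}"
  proof (rule mem_down_closed_iff_less_card)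
    show "finite {i. psum a i < k}" by (rule finite_subset[of _ "{..<e}"]) (use e in auto)
  qed (use psum_mono le_less_trans in blast)
  then show ?thesis by (simp add: eq)
qed

lemma keys_psi_expo:
  assumes "mdeg a = d" "1 \<le> d"
  shows "keys (psi_expo a) \<subseteq> {1..d}"
proof -
  define e where "e = Max (keys a)"
  have ne: "keys a \<noteq> {}" using assms by (auto simp: mdeg_def)
  have "psum a i < d" if "i < e" for i
  proof -
    define f where "f = e - 1"
    have f: "e = Suc f" "i \<le> f" using that by (simp_all add: f_def)
    have "lookup a e > 0" using Max_in[OF _ ne] by (simp add: e_def in_keys_iff)
    then have "psum a i < psum a e" using f psum_mono[of i f a] by (simp add: psum_Suc)
    then show ?thesis using psum_le_mdeg[of a e] assms by simp
  qed
  then show ?thesis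
    unfolding psi_expo_def e_def[symmetric] psum_def[symmetric]
    by (intro order_trans[OF keys_sum]) (auto simp: Suc_le_eq)
qed

text \<open>The Galois connection with \<open>a\<close> determines the partial sums of an exponent vector in
  \<open>{1..d}\<close>, hence the vector itself.\<close>

lemma psum_psi_expo_eqI:
  assumes "mdeg a = d" "1 \<le> d" "keys b \<subseteq> {1..d}"
    and "\<And>k i. 1 \<le> k \<Longrightarrow> k \<le> d \<Longrightarrow> psum a i < k \<longleftrightarrow> i < psum b k"
  shows "psi_expo a = b"
proof (rule psum_inject)
  have kp: "keys (psi_expo a) \<subseteq> {1..d}" using keys_psi_expo assms by blast
  have *: "psum (psi_expo a) k = psum b k" if "k \<le> d" for k
  proof (cases "k = 0")
    case True
    have "0 \<notin> keys (psi_expo a)" "0 \<notin> keys b" using kp assms(3) by auto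
    then show ?thesis using True by (simp add: psum_def in_keys_iff)
  next
    case False
    then have "i < psum (psi_expo a) k \<longleftrightarrow> i < psum b k" for i
      using psi_expo_galois[OF assms(1) that] assms(4) that by simp
    then show ?thesis by (metis less_irrefl not_less_iff_gr_or_eq)
  qed
  show "psum (psi_expo a) k = psum b k" for k
  proof (cases "k \<le> d")
    case False
    then have "psum (psi_expo a) k = mdeg (psi_expo a)" "psum b k = mdeg b"
      using kp assms(3) by (auto intro!: psum_eq_mdeg)
    moreover have "psum (psi_expo a) d = mdeg (psi_expo a)" "psum b d = mdeg b"
      using kp assms(3) by (auto intro!: psum_eq_mdeg)
    ultimately show ?thesis using *[of d] by simp
  qed (rule *)
qed

text \<open>Formally a consequence of the Galois connection: passing to the adjoint reverses the pointwise
  order. This is how dominance is transported between the two polynomial rings.\<close>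

lemma psum_le_iff_psi_expo:
  assumes "mdeg a = d" "mdeg a' = d" "1 \<le> d"
  shows "(\<forall>i. psum a i \<le> psum a' i) \<longleftrightarrow> (\<forall>k. psum (psi_expo a') k \<le> psum (psi_expo a) k)"
proof
  assume L: "\<forall>i. psum a i \<le> psum a' i"
  have *: "psum (psi_expo a') k \<le> psum (psi_expo a) k" if "k \<le> d" for k
  proof (rule ccontr)
    assume "\<not> psum (psi_expo a') k \<le> psum (psi_expo a) k"
    then have "psum (psi_expo a) k < psum (psi_expo a') k" by simp
    then have "psum a' (psum (psi_expo a) k) < k"
      using psi_expo_galois[OF assms(2) that] by simp
    then have "psum a (psum (psi_expo a) k) < k"
      using L le_less_trans by blast
    then show False using psi_expo_galois[OF assms(1) that, of "psum (psi_expo a) k"] by simp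
  qed
  show "\<forall>k. psum (psi_expo a') k \<le> psum (psi_expo a) k"
  proof
    fix k
    have eq: "psum (psi_expo c) k = psum (psi_expo c) (min k d)" if "mdeg c = d" for c
    proof (cases "k \<le> d")
      case False
      have "keys (psi_expo c) \<subseteq> {..d}" using keys_psi_expo[OF that] assms(3) by force
      moreover then have "keys (psi_expo c) \<subseteq> {..k}" using False by force
      ultimately show ?thesis using False by (simp add: psum_eq_mdeg min_def)
    qed (simp add: min_def)
    show "psum (psi_expo a') k \<le> psum (psi_expo a) k"
      using *[of "min k d"] eq[OF assms(1)] eq[OF assms(2)] by simp
  qed
next
  assume R: "\<forall>k. psum (psi_expo a') k \<le> psum (psi_expo a) k"
  show "\<forall>i. psum a i \<le> psum a' i"
  proof
    fix i
    show "psum a i \<le> psum a' i"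
    proof (rule ccontr)
      assume "\<not> psum a i \<le> psum a' i"
      then have lt: "psum a' i < psum a i" by simp
      then have k: "psum a i \<le> d" using psum_le_mdeg[of a i] assms by simp
      have "i < psum (psi_expo a') (psum a i)" using lt psi_expo_galois[OF assms(2) k] by simp
      then have "i < psum (psi_expo a) (psum a i)" using R less_le_trans by blast
      then show False using psi_expo_galois[OF assms(1) k, of i] by simp
    qed
  qed
qed

lemma bij_betw_psi_expo:
  assumes "1 \<le> d"
  shows "bij_betw psi_expo {a. mdeg a = d} {b. keys b \<subseteq> {1..d}}"
  unfolding bij_betw_def
proof
  show "inj_on psi_expo {a. mdeg a = d}"
  proof (rule inj_onI, rule psum_inject)
    fix a a' i assume "a \<in> {a. mdeg a = d}" "a' \<in> {a. mdeg a = d}" "psi_expo a = psi_expo a'"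
    then show "psum a i = psum a' i"
      using psum_le_iff_psi_expo[of a d a'] psum_le_iff_psi_expo[of a' d a] assms
      by (auto intro: antisym)
  qed
  show "psi_expo ` {a. mdeg a = d} = {b. keys b \<subseteq> {1..d}}"
  proof
    show "psi_expo ` {a. mdeg a = d} \<subseteq> {b. keys b \<subseteq> {1..d}}"
      using keys_psi_expo assms by auto
    show "{b. keys b \<subseteq> {1..d}} \<subseteq> psi_expo ` {a. mdeg a = d}"
    proof safe
      fix b :: expo assume b: "keys b \<subseteq> {1..d}"
      \<comment> \<open>the sorted list of indices of \<open>a\<close> consists of the partial sums of the gaps \<open>b\<close>\<close>
      define a where "a = (\<Sum>k\<in>{1..d}. single (psum b k) (1::nat))"
      have mdeg_sum: "mdeg (sum f A) = (\<Sum>x\<in>A. mdeg (f x))" for f :: "nat \<Rightarrow> expo" and A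
        by (induction A rule: infinite_finite_induct) (simp_all add: mdeg_add mdeg_eq_0_iff)
      have a: "mdeg a = d" by (simp add: a_def mdeg_sum)
      have psa: "psum a i = card {k\<in>{1..d}. psum b k \<le> i}" for i
        unfolding a_def psum_sum psum_single card_eq_sum
        by (rule sum.inter_filter[symmetric]) simp
      have "psi_expo a = b"
      proof (rule psum_psi_expo_eqI[OF a assms b])
        fix k i assume k: "1 \<le> k" "k \<le> d"
        show "psum a i < k \<longleftrightarrow> i < psum b k"
        proof
          assume lt: "i < psum b k"
          have "{k\<in>{1..d}. psum b k \<le> i} \<subseteq> {1..<k}"
          proof safe
            fix l assume l: "l \<in> {1..d}" "psum b l \<le> i"
            then have "\<not> k \<le> l" using psum_mono[of k l b] lt by auto
            then show "l \<in> {1..<k}" using l by simp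
          qed
          from card_mono[OF _ this] show "psum a i < k" using k by (simp add: psa)
        next
          assume lt: "psum a i < k"
          show "i < psum b k"
          proof (rule ccontr)
            assume "\<not> i < psum b k"
            then have "psum b l \<le> i" if "l \<le> k" for l
              using psum_mono[OF that, of b] by simp
            then have "{1..k} \<subseteq> {k\<in>{1..d}. psum b k \<le> i}" using k by auto
            from card_mono[OF _ this] show False using lt by (simp add: psa)
          qed
        qed
      qed
      then show "b \<in> psi_expo ` {a. mdeg a = d}" using a by auto
    qed
  qed
qed

section \<open>Complements of strongly stable sets under \<open>\<psi>\<close>\<close>

text \<open>The degree \<open>d\<close> parts of the ideals in \<open>ideals_A\<close>.\<close>

definition expos_A :: "nat \<Rightarrow> nat \<Rightarrow> expo set set"
  where "expos_A m d =
    {U. U \<subseteq> {t. keys t \<subseteq> {0..m} \<and> mdeg t = d} \<and> stable_expos {0..m} U \<and> U \<noteq> {}}"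

text \<open>The sets of exponents of the ideals in \<open>ideals_B\<close>; the two conditions on \<open>0\<close> and \<open>single d n\<close>
  stand for height \<open>d\<close>.\<close>

definition expos_B :: "nat \<Rightarrow> nat \<Rightarrow> expo set set"
  where "expos_B m d =
    {N. upset_expos {1..d} N \<and> stable_expos {1..d} N \<and> 0 \<notin> N \<and> (\<exists>n. single d n \<in> N) \<and>
        (\<forall>t\<in>N. \<exists>s\<in>N. \<exists>r. mdeg s \<le> m + 1 \<and> t = s + r)}"

definition psi_compl :: "nat \<Rightarrow> expo set \<Rightarrow> expo set"
  where "psi_compl d U = psi_expo ` {t. mdeg t = d \<and> t \<notin> U}"

lemma psi_expo_surj:
  assumes "1 \<le> d" "keys b \<subseteq> {1..d}"
  shows "\<exists>a. mdeg a = d \<and> b = psi_expo a"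
proof -
  have "b \<in> psi_expo ` {a. mdeg a = d}"
    using bij_betw_imp_surj_on[OF bij_betw_psi_expo[OF assms(1)]] assms(2) by simp
  then show ?thesis by auto
qed

text \<open>The degree of the image under \<open>\<psi>\<close> is \<open>c\<^sub>d\<close>, the largest index occurring in \<open>a\<close>.\<close>

lemma keys_subset_iff_mdeg_psi_expo:
  assumes "mdeg a = d" "1 \<le> d"
  shows "keys a \<subseteq> {0..m} \<longleftrightarrow> mdeg (psi_expo a) \<le> m"
proof -
  have "keys (psi_expo a) \<subseteq> {..d}" using keys_psi_expo[OF assms] by force
  then have "psum (psi_expo a) d = mdeg (psi_expo a)" by (rule psum_eq_mdeg)
  then have "psum a m < d \<longleftrightarrow> m < mdeg (psi_expo a)"
    using psi_expo_galois[OF assms(1), of d m] by simp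
  moreover have "psum a m \<le> d" using psum_le_mdeg[of a m] assms(1) by simp
  ultimately show ?thesis
    using assms(1) unfolding atLeast0AtMost keys_subset_iff_psum by auto
qed

lemma expo_divisor_of_mdeg:
  assumes "n \<le> mdeg t"
  shows "\<exists>s r. mdeg s = n \<and> t = s + r"
  using assms
proof (induction "mdeg t - n" arbitrary: t)
  case 0
  then show ?case by (intro exI[of _ t] exI[of _ 0]) simp
next
  case (Suc k)
  then have "t \<noteq> 0" using mdeg_eq_0_iff[of t] by auto
  then obtain j where "lookup t j > 0" by (metis gr0I lookup_zero poly_mapping_eqI)
  from expo_split_var[OF this] obtain t' where t': "t = t' + single j 1" by blast
  then have "mdeg t = Suc (mdeg t')" by (simp add: mdeg_add)
  with Suc obtain s r where "mdeg s = n" "t' = s + r" by (metis Suc_diff_le Suc_inject diff_Suc_Suc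
    not_less_eq_eq le_SucE nat.distinct(1) diff_self_eq_0)
  then show ?case by (intro exI[of _ s] exI[of _ "r + single j 1"]) (simp add: t' add.assoc)
qed

text \<open>Raising the partial sums of \<open>\<psi>(a)\<close> lowers those of \<open>a\<close>. By dominance, the resulting monomial
  can lie in the strongly stable set \<open>U\<close> only if \<open>a\<close> does.\<close>

lemma psum_mem_psi_compl:
  assumes "1 \<le> d" "stable_expos {0..m} U" "U \<subseteq> {t. keys t \<subseteq> {0..m} \<and> mdeg t = d}"
    and "b \<in> psi_compl d U" "keys b' \<subseteq> {1..d}" "\<And>k. psum b k \<le> psum b' k"
  shows "b' \<in> psi_compl d U"
proof -
  obtain a where a: "mdeg a = d" "a \<notin> U" "b = psi_expo a"
    using assms(4) by (auto simp: psi_compl_def)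
  obtain a' where a': "mdeg a' = d" "b' = psi_expo a'"
    using psi_expo_surj[OF assms(1,5)] by blast
  have le: "psum a' i \<le> psum a i" for i
    using psum_le_iff_psi_expo[OF a'(1) a(1) assms(1)] assms(6) a a' by simp
  have "a' \<notin> U"
  proof
    assume "a' \<in> U"
    then have ka': "keys a' \<subseteq> {0..m}" using assms(3) by auto
    then have "psum a m = d"
      using le[of m] psum_le_mdeg[of a m] a(1) a'(1) by (simp add: atLeast0AtMost psum_eq_mdeg)
    then have "keys a \<subseteq> {0..m}" using a(1) by (simp add: atLeast0AtMost keys_subset_iff_psum)
    from stable_expos_dominance[OF assms(2) \<open>a' \<in> U\<close> ka' this] show False
      using a a' le by simp
  qed
  then show ?thesis using a' by (auto simp: psi_compl_def)
qed

lemma psi_expo_eq_0_iff: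
  assumes "mdeg a = d" "1 \<le> d"
  shows "psi_expo a = 0 \<longleftrightarrow> a = single 0 d"
proof -
  have "keys a \<subseteq> {0..0} \<longleftrightarrow> psi_expo a = 0"
    using keys_subset_iff_mdeg_psi_expo[OF assms, of 0] by (simp add: mdeg_eq_0_iff)
  moreover have "keys a \<subseteq> {0..0} \<longleftrightarrow> a = single 0 d"
  proof
    assume k: "keys a \<subseteq> {0..0}"
    then have "keys a \<subseteq> {..0}" by auto
    from psum_eq_mdeg[OF this] assms have "lookup a 0 = d" by (simp add: psum_def)
    then show "a = single 0 d" using k
      by (intro poly_mapping_eqI) (force simp: lookup_single when_def in_keys_iff)
  qed auto
  ultimately show ?thesis by simp
qed

lemma psi_compl_mem_expos_B:
  assumes "1 \<le> d" "U \<in> expos_A m d"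
  shows "psi_compl d U \<in> expos_B m d"
proof -
  let ?N = "psi_compl d U"
  have U: "U \<subseteq> {t. keys t \<subseteq> {0..m} \<and> mdeg t = d}" "stable_expos {0..m} U" "U \<noteq> {}"
    using assms by (auto simp: expos_A_def)
  note dom = psum_mem_psi_compl[OF assms(1) U(2,1)]
  have kN: "keys t \<subseteq> {1..d}" if "t \<in> ?N" for t
    using that keys_psi_expo[OF _ assms(1)] by (auto simp: psi_compl_def)
  \<comment> \<open>a monomial of degree above \<open>m\<close> comes from one that involves some \<open>x\<^sub>i\<close> with \<open>i > m\<close>, which \<open>U\<close> cannot contain\<close>
  have big: "t \<in> ?N" if "keys t \<subseteq> {1..d}" "mdeg t > m" for t
  proof -
    obtain a where a: "mdeg a = d" "t = psi_expo a"
      using psi_expo_surj[OF assms(1) \<open>keys t \<subseteq> {1..d}\<close>] by blast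
    then have "a \<notin> U" using U(1) keys_subset_iff_mdeg_psi_expo[OF a(1) assms(1), of m] that(2) by auto
    then show ?thesis using a by (auto simp: psi_compl_def)
  qed
  have "upset_expos {1..d} ?N"
    unfolding upset_expos_def
  proof safe
    fix t r :: expo assume t: "t \<in> ?N" and r: "keys r \<subseteq> {1..d}"
    show "t + r \<in> ?N"
      by (rule dom[OF t]) (use kN[OF t] r in \<open>simp_all add: keys_add_expo psum_add\<close>)
  qed (use kN in blast)
  moreover have "stable_expos {1..d} ?N"
    unfolding stable_expos_def
  proof safe
    fix t i j assume t: "t \<in> ?N" and ij: "i \<in> {1..d}" "j \<in> {1..d}" "lookup t j > 0" "i < j"
    show "t - single j 1 + single i 1 \<in> ?N"
    proof (rule dom[OF t])
      show "keys (t - single j 1 + single i 1) \<subseteq> {1..d}"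
        using keys_move[of t j i] kN[OF t] ij(1) by blast
    qed (simp only: psum_move[OF ij(3,4)] le_add1)
  qed
  moreover have "0 \<notin> ?N"
  proof
    assume "0 \<in> ?N"
    then have no: "single 0 d \<notin> U"
      using psi_expo_eq_0_iff[OF _ assms(1)] by (auto simp: psi_compl_def)
    obtain s where s: "s \<in> U" using U(3) by auto
    have "single 0 d \<in> U"
    proof (rule stable_expos_dominance[OF U(2) s])
      show "psum s i \<le> psum (single 0 d) i" for i
        using psum_le_mdeg[of s i] U(1) s by (auto simp: psum_single)
    qed (use U(1) s in auto)
    then show False using no by simp
  qed
  moreover have "\<exists>n. single d n \<in> ?N"
    by (rule exI[of _ "m + 1"], rule big) (use assms(1) in auto)
  moreover have "\<exists>s\<in>?N. \<exists>r. mdeg s \<le> m + 1 \<and> t = s + r" if t: "t \<in> ?N" for t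
  proof (cases "mdeg t \<le> m")
    case True
    then show ?thesis using t by (intro bexI[of _ t] exI[of _ 0]) auto
  next
    case False
    then obtain s r where sr: "mdeg s = m + 1" "t = s + r"
      using expo_divisor_of_mdeg[of "m + 1" t] by auto
    moreover from sr have "s \<in> ?N" using kN[OF t] by (intro big) (auto simp: keys_add_expo)
    ultimately show ?thesis by (intro bexI[of _ s] exI[of _ r]) simp_all
  qed
  ultimately show ?thesis by (simp add: expos_B_def)
qed

lemma expos_B_preimage:
  assumes "1 \<le> d" "N \<in> expos_B m d"
  shows "\<exists>U\<in>expos_A m d. psi_compl d U = N"
proof -
  have N: "upset_expos {1..d} N" "stable_expos {1..d} N" "0 \<notin> N" "\<exists>n. single d n \<in> N"
    "\<And>t. t\<in>N \<Longrightarrow> \<exists>s\<in>N. \<exists>r. mdeg s \<le> m + 1 \<and> t = s + r"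
    using assms(2) by (auto simp: expos_B_def)
  have kN: "keys t \<subseteq> {1..d}" if "t \<in> N" for t using N(1) that by (auto simp: upset_expos_def)
  note dom = stable_upset_dominance[OF N(1,2) _ _ assms(1)]
  \<comment> \<open>a generator dividing a power of \<open>y\<^sub>d\<close> is a power of \<open>y\<^sub>d\<close>; its exponent is at most \<open>m + 1\<close>\<close>
  have "\<exists>s\<in>N. mdeg s \<le> m + 1 \<and> keys s \<subseteq> {d}"
  proof -
    obtain n where "single d n \<in> N" using N(4) by auto
    from N(5)[OF this] obtain s r where sr: "s \<in> N" "mdeg s \<le> m + 1" "single d n = s + r" by auto
    have "keys s \<subseteq> keys (single d n)" unfolding sr(3) keys_add_expo by auto
    also have "\<dots> \<subseteq> {d}" by simp
    finally show ?thesis using sr(1,2) by blast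
  qed
  then obtain s where s: "s \<in> N" "mdeg s \<le> m + 1" "keys s \<subseteq> {d}" by auto
  \<comment> \<open>the partial sums of \<open>y\<^sub>d\<^sup>n\<close> vanish before \<open>d\<close>, so every monomial of degree at least \<open>n\<close> dominates it\<close>
  have big: "t \<in> N" if t: "keys t \<subseteq> {1..d}" "m < mdeg t" for t
  proof (rule dom[OF s(1) t(1)])
    fix i show "psum s i \<le> psum t i"
    proof (cases "d \<le> i")
      case True
      then have "keys t \<subseteq> {..i}" using t by auto
      then show ?thesis using s(2) t(2) psum_le_mdeg[of s i] by (simp add: psum_eq_mdeg)
    next
      case False
      then have "psum s i = 0" using s(3) by (auto simp: psum_def in_keys_iff subset_iff)
      then show ?thesis by simp
    qed
  qed
  define U where "U = {a. mdeg a = d \<and> psi_expo a \<notin> N}"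
  have "keys a \<subseteq> {0..m}" if "a \<in> U" for a
  proof (rule ccontr)
    assume "\<not> keys a \<subseteq> {0..m}"
    then have "m < mdeg (psi_expo a)"
      using that keys_subset_iff_mdeg_psi_expo[of a d m] assms(1) by (auto simp: U_def)
    then have "psi_expo a \<in> N" using that by (intro big keys_psi_expo) (use assms(1) in \<open>auto simp: U_def\<close>)
    then show False using that by (simp add: U_def)
  qed
  moreover have "stable_expos {0..m} U"
    unfolding stable_expos_def
  proof safe
    fix a i j assume a: "a \<in> U" and ij: "i \<in> {0..m}" "j \<in> {0..m}" "lookup a j > 0" "i < j"
    define a' where "a' = a - single j 1 + single i 1"
    have ad: "mdeg a = d" and a'd: "mdeg a' = d"
      using a mdeg_move[OF ij(3)] by (auto simp: U_def a'_def)
    have "\<forall>k. psum a k \<le> psum a' k"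
      unfolding a'_def psum_move[OF ij(3,4)] by simp
    then have le: "psum (psi_expo a') k \<le> psum (psi_expo a) k" for k
      using psum_le_iff_psi_expo[OF ad a'd assms(1)] by simp
    have "psi_expo a' \<notin> N"
    proof
      assume "psi_expo a' \<in> N"
      from dom[OF this keys_psi_expo[OF ad assms(1)] le] show False using a by (simp add: U_def)
    qed
    then show "a - single j 1 + single i 1 \<in> U" using a'd by (simp add: U_def a'_def)
  qed
  moreover have "single 0 d \<in> U"
    using psi_expo_eq_0_iff[of "single 0 d" d] assms(1) N(3) by (simp add: U_def)
  moreover have "psi_compl d U = N"
  proof -
    have "{t. mdeg t = d \<and> t \<notin> U} = {t. mdeg t = d \<and> psi_expo t \<in> N}" by (auto simp: U_def)
    then have "psi_compl d U = psi_expo ` {t. mdeg t = d} \<inter> N" by (auto simp: psi_compl_def)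
    also have "\<dots> = N" using bij_betw_psi_expo[OF assms(1)] kN by (auto simp: bij_betw_def)
    finally show ?thesis .
  qed
  moreover have "U \<subseteq> {a. mdeg a = d}" by (auto simp: U_def)
  ultimately show ?thesis by (intro bexI[of _ U]) (auto simp: expos_A_def)
qed

lemma bij_betw_psi_compl:
  assumes "1 \<le> d"
  shows "bij_betw (psi_compl d) (expos_A m d) (expos_B m d)"
  unfolding bij_betw_def
proof
  show "inj_on (psi_compl d) (expos_A m d)"
  proof (rule inj_onI)
    fix U U' assume U: "U \<in> expos_A m d" "U' \<in> expos_A m d" and eq: "psi_compl d U = psi_compl d U'"
    have inj: "inj_on psi_expo {a. mdeg a = d}"
      using bij_betw_psi_expo[OF assms] by (simp add: bij_betw_def)
    from eq have "{t. mdeg t = d \<and> t \<notin> U} = {t. mdeg t = d \<and> t \<notin> U'}"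
      unfolding psi_compl_def by (subst (asm) inj_on_image_eq_iff[OF inj]) auto
    then show "U = U'" using U unfolding expos_A_def by blast
  qed
  show "psi_compl d ` expos_A m d = expos_B m d"
    using psi_compl_mem_expos_B[OF assms] expos_B_preimage[OF assms] by fast
qed

section \<open>Monomial ideals as sets of exponents\<close>

text \<open>The span of a set of monomials. It is an ideal when the set is closed under multiplication by
  variables; carriers of polynomial rings and degree components are of this form as well.\<close>

definition mon_ideal :: "expo set \<Rightarrow> 'k::field mpoly set"
  where "mon_ideal N = {p. keys p \<subseteq> N}"

lemma poly_ring_simps [simp]:
  "mult (poly_ring X) = (*)" "one (poly_ring X) = 1" "zero (poly_ring X) = 0"
  "add (poly_ring X) = (+)"
  by (simp_all add: poly_ring_def)

lemma carrier_poly_ring: "carrier (poly_ring X) = mon_ideal {t. keys t \<subseteq> X}"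
  by (auto simp: poly_ring_def mon_ideal_def)

lemma mon_ideal_0: "0 \<in> mon_ideal N"
  by (simp add: mon_ideal_def)

lemma mon_ideal_add: "p \<in> mon_ideal N \<Longrightarrow> q \<in> mon_ideal N \<Longrightarrow> p + q \<in> mon_ideal N"
  using keys_add[of p q] by (auto simp: mon_ideal_def)

lemma keys_uminus: "keys (- p :: 'k::field mpoly) = keys p"
  by (auto simp: in_keys_iff)

lemma mon_ideal_uminus: "(p :: 'k::field mpoly) \<in> mon_ideal N \<Longrightarrow> - p \<in> mon_ideal N"
  by (simp add: mon_ideal_def keys_uminus)

lemma mon_ideal_mult:
  assumes "p \<in> mon_ideal M" "q \<in> mon_ideal N" "\<And>s t. s \<in> M \<Longrightarrow> t \<in> N \<Longrightarrow> s + t \<in> L"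
  shows "p * q \<in> mon_ideal L"
  using assms keys_mult[of p q] unfolding mon_ideal_def by blast

lemma mon_ideal_mono: "M \<subseteq> N \<Longrightarrow> mon_ideal M \<subseteq> mon_ideal N"
  by (auto simp: mon_ideal_def)

lemma monomial_mem_mon_ideal_iff [simp]: "monomial t \<in> mon_ideal N \<longleftrightarrow> t \<in> N"
  by (simp add: monomial_def mon_ideal_def)

lemma mon_ideal_eq_iff: "(mon_ideal M :: 'k::field mpoly set) = mon_ideal N \<longleftrightarrow> M = N"
  by (metis monomial_mem_mon_ideal_iff subset_antisym subsetI)

lemma const_mem_carrier [simp]: "single 0 c \<in> carrier (poly_ring X)"
  by (simp add: carrier_poly_ring mon_ideal_def)

lemma cring_poly_ring: "cring (poly_ring X :: 'k::field mpoly ring)"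
proof (rule cringI)
  let ?C = "carrier (poly_ring X :: 'k mpoly ring)"
  have one: "1 \<in> ?C" by (simp add: carrier_poly_ring mon_ideal_def)
  have mult: "p * q \<in> ?C" if "p \<in> ?C" "q \<in> ?C" for p q
    using that unfolding carrier_poly_ring
    by (rule mon_ideal_mult) (auto simp: keys_add_expo)
  show "abelian_group (poly_ring X :: 'k mpoly ring)"
  proof (rule abelian_groupI)
    fix p assume "p \<in> ?C"
    then show "\<exists>q\<in>?C. q \<oplus>\<^bsub>poly_ring X\<^esub> p = \<zero>\<^bsub>poly_ring X\<^esub>"
      by (intro bexI[of _ "- p"]) (auto simp: carrier_poly_ring mon_ideal_uminus)
  qed (auto simp: carrier_poly_ring mon_ideal_0 mon_ideal_add add_ac)
  show "comm_monoid (poly_ring X :: 'k mpoly ring)"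
    by (rule comm_monoidI) (auto simp: one mult mult_ac)
qed (auto simp: distrib_right)

interpretation poly_ring: cring "poly_ring X :: 'k::field mpoly ring" for X
  by (rule cring_poly_ring)

context
  fixes I :: "'k::field mpoly set" and X
  assumes I: "ideal I (poly_ring X)"
begin

lemma ideal_poly_ring_subset: "I \<subseteq> carrier (poly_ring X)"
  by (rule additive_subgroup.a_subset[OF ideal.axioms(1)[OF I]])

lemma ideal_poly_ring_0: "0 \<in> I"
  using additive_subgroup.zero_closed[OF ideal.axioms(1)[OF I]] by simp

lemma ideal_poly_ring_add: "p \<in> I \<Longrightarrow> q \<in> I \<Longrightarrow> p + q \<in> I"
  using additive_subgroup.a_closed[OF ideal.axioms(1)[OF I]] by simp

lemma ideal_poly_ring_mult: "p \<in> carrier (poly_ring X) \<Longrightarrow> q \<in> I \<Longrightarrow> p * q \<in> I"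
  using ideal.I_l_closed[OF I] by simp

lemma ideal_poly_ring_uminus: "p \<in> I \<Longrightarrow> - p \<in> I"
  using ideal_poly_ring_mult[OF const_mem_carrier[of "- 1"], of p]
  unfolding single_uminus single_one by simp

lemma ideal_poly_ring_diff: "p \<in> I \<Longrightarrow> q \<in> I \<Longrightarrow> p - q \<in> I"
  using ideal_poly_ring_add[OF _ ideal_poly_ring_uminus] by fastforce

lemma ideal_poly_ring_sum: "(\<And>a. a \<in> A \<Longrightarrow> f a \<in> I) \<Longrightarrow> sum f A \<in> I"
  by (induction A rule: infinite_finite_induct) (auto simp: ideal_poly_ring_0 ideal_poly_ring_add)

end

lemma ideal_mon_ideal:
  assumes "upset_expos X N"
  shows "ideal (mon_ideal N :: 'k::field mpoly set) (poly_ring X)"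
proof (rule idealI[OF poly_ring.ring_axioms])
  have N: "N \<subseteq> {t. keys t \<subseteq> X}" "\<And>t r. t \<in> N \<Longrightarrow> keys r \<subseteq> X \<Longrightarrow> t + r \<in> N"
    using assms by (auto simp: upset_expos_def)
  show "subgroup (mon_ideal N) (add_monoid (poly_ring X :: 'k mpoly ring))"
  proof (rule poly_ring.add.subgroupI)
    fix p :: "'k mpoly" assume p: "p \<in> mon_ideal N"
    then have "- p \<in> carrier (poly_ring X)"
      using mon_ideal_mono[OF N(1)] mon_ideal_uminus by (auto simp: carrier_poly_ring)
    moreover have "p \<in> carrier (poly_ring X)" using p mon_ideal_mono[OF N(1)]
      by (auto simp: carrier_poly_ring)
    ultimately have "\<ominus>\<^bsub>poly_ring X\<^esub> p = - p" by (intro poly_ring.minus_equality) simp_all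
    then show "\<ominus>\<^bsub>poly_ring X\<^esub> p \<in> mon_ideal N" using p by (simp add: mon_ideal_uminus)
  qed (use mon_ideal_mono[OF N(1)] mon_ideal_0 in \<open>auto simp: carrier_poly_ring mon_ideal_add\<close>)
  fix p q :: "'k mpoly" assume pq: "p \<in> mon_ideal N" "q \<in> carrier (poly_ring X)"
  have "q * p \<in> mon_ideal N"
    by (rule mon_ideal_mult[OF pq(2)[unfolded carrier_poly_ring] pq(1)])
      (subst add.commute, use N(2) in simp)
  then show "q \<otimes>\<^bsub>poly_ring X\<^esub> p \<in> mon_ideal N" "p \<otimes>\<^bsub>poly_ring X\<^esub> q \<in> mon_ideal N"
    by (simp_all add: mult.commute)
qed

lemma poly_eq_sum_monomials:
  "p = (\<Sum>t\<in>keys p. kscale (lookup p t) (monomial t))"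
proof (rule poly_mapping_eqI)
  fix t
  have "lookup (\<Sum>t\<in>keys p. kscale (lookup p t) (monomial t)) t =
      (\<Sum>s\<in>keys p. if s = t then lookup p s else 0)"
    by (simp add: lookup_sum kscale_def monomial_def mult_single lookup_single when_def)
  then show "lookup p t = lookup (\<Sum>t\<in>keys p. kscale (lookup p t) (monomial t)) t"
    by (simp add: in_keys_iff)
qed

lemma monomial_mult: "monomial (s + t) = (monomial s * monomial t :: 'k::field mpoly)"
  by (simp add: monomial_def mult_single)

lemma mon_ideal_eq_genideal:
  assumes "upset_expos X N" "T \<subseteq> N" "\<And>t. t \<in> N \<Longrightarrow> \<exists>s\<in>T. \<exists>r. t = s + r"
  shows "(mon_ideal N :: 'k::field mpoly set) = Idl\<^bsub>poly_ring X\<^esub> (monomial ` T)"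
proof
  let ?I = "Idl\<^bsub>poly_ring X\<^esub> (monomial ` T) :: 'k mpoly set"
  show "?I \<subseteq> mon_ideal N"
    by (rule poly_ring.genideal_minimal[OF ideal_mon_ideal[OF assms(1)]]) (use assms(2) in auto)
  have N: "keys t \<subseteq> X" if "t \<in> N" for t using that assms(1) by (auto simp: upset_expos_def)
  then have sub: "(monomial ` T :: 'k mpoly set) \<subseteq> carrier (poly_ring X)"
    using assms(2) by (auto simp: carrier_poly_ring)
  note I = poly_ring.genideal_ideal[OF this]
  have mon: "monomial t \<in> ?I" if t: "t \<in> N" for t
  proof -
    obtain s r where sr: "s \<in> T" "t = s + r" using assms(3)[OF t] by auto
    have "monomial s \<in> ?I" using poly_ring.genideal_self[OF sub] sr by auto
    moreover have "(monomial r :: 'k mpoly) \<in> carrier (poly_ring X)"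
      using N[OF t] by (simp add: carrier_poly_ring sr(2) keys_add_expo)
    ultimately have "monomial r * monomial s \<in> ?I" by (intro ideal_poly_ring_mult[OF I])
    then show ?thesis by (simp add: sr monomial_mult mult.commute)
  qed
  show "mon_ideal N \<subseteq> ?I"
  proof
    fix p :: "'k mpoly" assume p: "p \<in> mon_ideal N"
    have "(\<Sum>t\<in>keys p. kscale (lookup p t) (monomial t)) \<in> ?I"
      unfolding kscale_def
      by (intro ideal_poly_ring_sum[OF I] ideal_poly_ring_mult[OF I] mon const_mem_carrier)
        (use p in \<open>auto simp: mon_ideal_def\<close>)
    then show "p \<in> ?I" by (simp only: poly_eq_sum_monomials[of p, symmetric])
  qed
qed

lemma monomial_ideal_iff:
  "monomial_ideal X (I :: 'k::field mpoly set) \<longleftrightarrow> (\<exists>N. upset_expos X N \<and> I = mon_ideal N)"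
proof
  assume "monomial_ideal X I"
  then obtain T where T: "T \<subseteq> {t. keys t \<subseteq> X}" "I = Idl\<^bsub>poly_ring X\<^esub> (monomial ` T)"
    by (auto simp: monomial_ideal_def)
  define N where "N = {t. keys t \<subseteq> X \<and> (\<exists>s\<in>T. \<exists>r. t = s + r)}"
  have N: "upset_expos X N"
    unfolding upset_expos_def N_def by (auto simp: keys_add_expo) (metis add.assoc)
  moreover have "T \<subseteq> N" using T(1) unfolding N_def by (auto intro!: bexI exI[of _ 0])
  ultimately have "I = mon_ideal N"
    unfolding T(2) by (intro mon_ideal_eq_genideal[symmetric]) (auto simp: N_def)
  with N show "\<exists>N. upset_expos X N \<and> I = mon_ideal N" by blast
next
  assume "\<exists>N. upset_expos X N \<and> I = mon_ideal N"
  then obtain N where N: "upset_expos X N" "I = mon_ideal N" by blast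
  have "I = Idl\<^bsub>poly_ring X\<^esub> (monomial ` N)"
    unfolding N(2) by (rule mon_ideal_eq_genideal[OF N(1)]) (auto intro!: bexI exI[of _ 0])
  moreover have "N \<subseteq> {t. keys t \<subseteq> X}" using N(1) by (simp add: upset_expos_def)
  moreover have "ideal I (poly_ring X)" unfolding N(2) by (rule ideal_mon_ideal[OF N(1)])
  ultimately show "monomial_ideal X I" unfolding monomial_ideal_def by blast
qed

lemma strongly_stable_iff: "strongly_stable X I \<longleftrightarrow> stable_expos X {t. monomial t \<in> I}"
  unfolding strongly_stable_def stable_expos_def by blast

text \<open>Homogeneous generators may be replaced by monomials: every monomial occurring in a
  homogeneous generator of degree \<open>n\<close> has degree \<open>n\<close> and lies in the ideal, so the monomials of the
  ideal with degree in \<open>D\<close> generate everything that the given generators do.\<close>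

lemma generated_in_degrees_mon_ideal_iff:
  assumes "upset_expos X N"
  shows "generated_in_degrees X D (mon_ideal N :: 'k::field mpoly set) \<longleftrightarrow>
    (\<forall>t\<in>N. \<exists>s\<in>N. \<exists>r. mdeg s \<in> D \<and> t = s + r)"
proof
  assume "generated_in_degrees X D (mon_ideal N :: 'k mpoly set)"
  then obtain G :: "'k mpoly set" where G: "G \<subseteq> carrier (poly_ring X)"
    "\<And>g. g \<in> G \<Longrightarrow> \<exists>n\<in>D. homogeneous n g" "mon_ideal N = Idl\<^bsub>poly_ring X\<^esub> G"
    by (auto simp: generated_in_degrees_def)
  define M where "M = {t\<in>N. \<exists>s\<in>N. \<exists>r. mdeg s \<in> D \<and> t = s + r}"
  have M: "upset_expos X M"
    using assms unfolding upset_expos_def M_def by (auto simp: keys_add_expo) (metis add.assoc)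
  have "G \<subseteq> mon_ideal M"
  proof
    fix g assume g: "g \<in> G"
    then obtain n where n: "n \<in> D" "homogeneous n g" using G(2) by auto
    have "g \<in> mon_ideal N" unfolding G(3) using poly_ring.genideal_self[OF G(1)] g by auto
    then show "g \<in> mon_ideal M"
      using n by (auto simp: mon_ideal_def M_def homogeneous_def intro!: bexI exI[of _ 0])
  qed
  then have "(mon_ideal N :: 'k mpoly set) \<subseteq> mon_ideal M"
    unfolding G(3) by (rule poly_ring.genideal_minimal[OF ideal_mon_ideal[OF M]])
  then have "N \<subseteq> M" using monomial_mem_mon_ideal_iff by (metis subset_iff)
  then show "\<forall>t\<in>N. \<exists>s\<in>N. \<exists>r. mdeg s \<in> D \<and> t = s + r" by (auto simp: M_def)
next
  assume gen: "\<forall>t\<in>N. \<exists>s\<in>N. \<exists>r. mdeg s \<in> D \<and> t = s + r"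
  define T where "T = {t\<in>N. mdeg t \<in> D}"
  have "(mon_ideal N :: 'k mpoly set) = Idl\<^bsub>poly_ring X\<^esub> (monomial ` T)"
  proof (rule mon_ideal_eq_genideal[OF assms])
    show "\<exists>s\<in>T. \<exists>r. t = s + r" if "t \<in> N" for t
      using gen that unfolding T_def by blast
  qed (auto simp: T_def)
  moreover have "(monomial ` T :: 'k mpoly set) \<subseteq> carrier (poly_ring X)"
    using assms by (auto simp: T_def upset_expos_def carrier_poly_ring)
  moreover have "\<forall>g\<in>(monomial ` T :: 'k mpoly set). \<exists>n\<in>D. homogeneous n g"
    by (auto simp: T_def homogeneous_def monomial_def)
  ultimately show "generated_in_degrees X D (mon_ideal N :: 'k mpoly set)"
    unfolding generated_in_degrees_def by blast
qed

lemma span_monomials: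
  "kspace.span {monomial t | t. t \<in> T} = (mon_ideal T :: 'k::field mpoly set)"
proof
  show "kspace.span {monomial t | t. t \<in> T} \<subseteq> (mon_ideal T :: 'k mpoly set)"
  proof (rule kspace.span_minimal)
    show "kspace.subspace (mon_ideal T :: 'k mpoly set)"
    proof (rule kspace.subspaceI)
      fix c and p :: "'k mpoly" assume "p \<in> mon_ideal T"
      then show "kscale c p \<in> mon_ideal T"
        unfolding kscale_def
        by (intro mon_ideal_mult[where M = "{0}" and N = T]) (auto simp: mon_ideal_def)
    qed (simp_all add: mon_ideal_0 mon_ideal_add)
  qed auto
  show "(mon_ideal T :: 'k mpoly set) \<subseteq> kspace.span {monomial t | t. t \<in> T}"
  proof
    fix p :: "'k mpoly" assume "p \<in> mon_ideal T"
    then have "(\<Sum>t\<in>keys p. kscale (lookup p t) (monomial t)) \<in> kspace.span {monomial t | t. t \<in> T}"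
      by (intro kspace.span_sum kspace.span_scale kspace.span_base) (auto simp: mon_ideal_def)
    then show "p \<in> kspace.span {monomial t | t. t \<in> T}" by (simp only: poly_eq_sum_monomials[of p, symmetric])
  qed
qed

lemma psi_image_mon_ideal:
  assumes "inj_on psi_expo T"
  shows "psi ` mon_ideal T = (mon_ideal (psi_expo ` T) :: 'k::field mpoly set)"
proof
  show "psi ` mon_ideal T \<subseteq> (mon_ideal (psi_expo ` T) :: 'k mpoly set)"
  proof safe
    fix p :: "'k mpoly" assume p: "p \<in> mon_ideal T"
    have "psi p \<in> kspace.span {monomial t | t. t \<in> psi_expo ` T}"
      unfolding psi_def
      by (intro kspace.span_sum kspace.span_scale kspace.span_base)
        (use p in \<open>auto simp: mon_ideal_def\<close>)
    then show "psi p \<in> mon_ideal (psi_expo ` T)" by (simp only: span_monomials)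
  qed
  show "(mon_ideal (psi_expo ` T) :: 'k mpoly set) \<subseteq> psi ` mon_ideal T"
  proof
    fix q :: "'k mpoly" assume q: "q \<in> mon_ideal (psi_expo ` T)"
    define A where "A = {a\<in>T. psi_expo a \<in> keys q}"
    have inj: "inj_on psi_expo A" using assms by (auto simp: A_def intro: inj_on_subset)
    have im: "psi_expo ` A = keys q" using q by (auto simp: A_def mon_ideal_def)
    have fin: "finite A" using inj im by (metis finite_imageD finite_keys)
    define p :: "'k mpoly" where "p = (\<Sum>a\<in>A. single a (lookup q (psi_expo a)))"
    have lp: "lookup p a = (if a \<in> A then lookup q (psi_expo a) else 0)" for a
      using fin by (simp add: p_def lookup_sum lookup_single when_def)
    have kp: "keys p = A" by (auto simp: in_keys_iff lp A_def split: if_splits)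
    have "psi p = (\<Sum>a\<in>A. kscale (lookup q (psi_expo a)) (monomial (psi_expo a)))"
      unfolding psi_def kp by (rule sum.cong) (simp_all add: lp)
    also have "\<dots> = (\<Sum>b\<in>psi_expo ` A. kscale (lookup q b) (monomial b))"
      by (simp add: sum.reindex[OF inj])
    also have "\<dots> = q" unfolding im by (rule poly_eq_sum_monomials[symmetric])
    finally have "q = psi p" by simp
    moreover have "p \<in> mon_ideal T" unfolding mon_ideal_def using kp by (auto simp: A_def)
    ultimately show "q \<in> psi ` mon_ideal T" by blast
  qed
qed

section \<open>Dimension of the polynomial ring\<close>

text \<open>The value of the monomial with exponent list \<open>es\<close> at the tuple \<open>x\<close>. Lists allow induction on the
  number of variables by splitting off the first one.\<close>

fun mval :: "(nat \<Rightarrow> 'k::field mpoly) \<Rightarrow> nat list \<Rightarrow> 'k mpoly" where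
  "mval x [] = 1"
| "mval x (k # es) = x 0 ^ k * mval (\<lambda>i. x (Suc i)) es"

lemma carrier_poly_ring_mult:
  "p \<in> carrier (poly_ring X) \<Longrightarrow> q \<in> carrier (poly_ring X) \<Longrightarrow> p * q \<in> carrier (poly_ring X)"
  using poly_ring.m_closed[of p X q] by simp

lemma carrier_poly_ring_one: "1 \<in> carrier (poly_ring X)"
  using poly_ring.one_closed[of X] by simp

lemma carrier_poly_ring_power:
  "p \<in> carrier (poly_ring X) \<Longrightarrow> p ^ k \<in> carrier (poly_ring X)"
  by (induction k) (auto simp: carrier_poly_ring_one carrier_poly_ring_mult)

lemma mval_carrier:
  "(\<And>i. i < length es \<Longrightarrow> x i \<in> carrier (poly_ring X)) \<Longrightarrow> mval x es \<in> carrier (poly_ring X)"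
proof (induction es arbitrary: x)
  case (Cons k es)
  then have "x 0 \<in> carrier (poly_ring X)" "mval (\<lambda>i. x (Suc i)) es \<in> carrier (poly_ring X)" by auto
  then show ?case by (simp add: carrier_poly_ring_mult carrier_poly_ring_power)
qed (simp add: carrier_poly_ring_one)

context
  fixes P :: "'k::field mpoly set" and X
  assumes P: "primeideal P (poly_ring X)"
begin

lemma primeideal_ideal: "ideal P (poly_ring X)"
  using P by (simp add: primeideal_def)

lemma primeideal_prime:
  "p \<in> carrier (poly_ring X) \<Longrightarrow> q \<in> carrier (poly_ring X) \<Longrightarrow> p * q \<in> P \<Longrightarrow> p \<in> P \<or> q \<in> P"
  using primeideal.I_prime[OF P] by simp

lemma primeideal_const:
  assumes "single 0 c \<in> P" shows "c = 0"
proof (rule ccontr)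
  assume "c \<noteq> 0"
  then have one: "1 \<in> P"
    using ideal_poly_ring_mult[OF primeideal_ideal const_mem_carrier[of "inverse c"] assms]
    by (simp add: mult_single)
  have "carrier (poly_ring X) \<subseteq> P"
    using ideal_poly_ring_mult[OF primeideal_ideal _ one] by auto
  then show False
    using primeideal.I_notcarr[OF P] ideal_poly_ring_subset[OF primeideal_ideal] by auto
qed

lemma primeideal_power:
  assumes "p \<in> carrier (poly_ring X)" "p ^ k \<in> P" shows "p \<in> P"
  using assms(2)
proof (induction k)
  case 0
  then have "single 0 1 \<in> P" by simp
  from primeideal_const[OF this] show ?case by simp
next
  case (Suc k)
  then show ?case using primeideal_prime[OF assms(1) carrier_poly_ring_power[OF assms(1)]] by auto
qed

end

text \<open>Elements picked along a chain of primes are algebraically independent modulo the bottom prime.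
  In a relation, let \<open>k\<close> be the least exponent of \<open>x\<^sub>0\<close> that occurs and factor out its power: since
  \<open>x\<^sub>0\<close> is outside the prime \<open>c 0\<close>, the relation reads \<open>g + x\<^sub>0 h \<in> c 0 \<subseteq> c 1\<close> with \<open>g\<close> free of \<open>x\<^sub>0\<close>.
  As \<open>x\<^sub>0 \<in> c 1\<close>, this leaves \<open>g \<in> c 1\<close>, a relation along the shorter chain starting at \<open>c 1\<close>.\<close>

lemma prime_chain_independent:
  fixes c :: "nat \<Rightarrow> 'k::field mpoly set"
  assumes "\<And>i. i \<le> n \<Longrightarrow> primeideal (c i) (poly_ring X)"
    and "\<And>i. i < n \<Longrightarrow> c i \<subseteq> c (Suc i)"
    and "\<And>i. i < n \<Longrightarrow> x i \<in> c (Suc i) - c i"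
    and "finite A" "\<And>es. es \<in> A \<Longrightarrow> length es = n"
    and "(\<Sum>es\<in>A. kscale (u es) (mval x es)) \<in> c 0"
    and "es \<in> A"
  shows "u es = 0"
  using assms
proof (induction n arbitrary: c x A u es)
  case 0
  have A: "A = {[]}" using 0(5,7) by auto
  then have "single 0 (u []) \<in> c 0" using 0(6) by (simp add: kscale_def)
  from primeideal_const[OF 0(1)[of 0, simplified] this] show ?case using 0(7) A by simp
next
  case (Suc n)
  let ?R = "poly_ring X :: 'k mpoly ring"
  define x' where "x' = (\<lambda>i. x (Suc i))"
  define c' where "c' = (\<lambda>i. c (Suc i))"
  have prime: "primeideal (c i) ?R" if "i \<le> Suc n" for i using Suc.prems(1) that by blast
  note id = primeideal_ideal[OF prime]
  have xc: "x i \<in> carrier ?R" if "i < Suc n" for i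
    using Suc.prems(3)[of i] ideal_poly_ring_subset[OF id[of "Suc i"]] that by auto
  have mc: "mval x' es \<in> carrier ?R" if "length es = n" for es
    by (rule mval_carrier) (simp add: that x'_def xc)
  show ?case
  proof (rule ccontr)
    assume "u es \<noteq> 0"
    then have ex: "\<exists>k. \<exists>fs. k # fs \<in> A \<and> u (k # fs) \<noteq> 0"
      using Suc.prems(5)[OF Suc.prems(7)] Suc.prems(7) by (cases es) auto
    define k where "k = (LEAST k. \<exists>fs. k # fs \<in> A \<and> u (k # fs) \<noteq> 0)"
    obtain fs where fs: "k # fs \<in> A" "u (k # fs) \<noteq> 0" using LeastI_ex[OF ex] by (auto simp: k_def)
    have least: "u (l # gs) = 0" if "l < k" "l # gs \<in> A" for l gs
      using not_less_Least[of l "\<lambda>k. \<exists>fs. k # fs \<in> A \<and> u (k # fs) \<noteq> 0"] that by (auto simp: k_def)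
    \<comment> \<open>\<open>B\<close> collects the terms with exactly \<open>x\<^sub>0\<^sup>k\<close>, \<open>C\<close> those divisible by a higher power of \<open>x\<^sub>0\<close>\<close>
    define B where "B = {fs. k # fs \<in> A}"
    define C where "C = {es\<in>A. k < hd es}"
    have "B \<subseteq> tl ` A"
    proof
      fix gs assume "gs \<in> B"
      then have "tl (k # gs) \<in> tl ` A" unfolding B_def by blast
      then show "gs \<in> tl ` A" by simp
    qed
    then have finB: "finite B" using Suc.prems(4) by (simp add: finite_subset)
    define g where "g = (\<Sum>fs\<in>B. kscale (u (k # fs)) (mval x' fs))"
    define h where "h = (\<Sum>es\<in>C. kscale (u es) (x 0 ^ (hd es - k - 1) * mval x' (tl es)))"
    have C_term: "kscale (u es) (mval x es) =
        x 0 ^ k * (x 0 * kscale (u es) (x 0 ^ (hd es - k - 1) * mval x' (tl es)))" if "es \<in> C" for es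
    proof -
      have "es \<noteq> []" using that Suc.prems(5)[of es] by (auto simp: C_def)
      then obtain l gs where es: "es = l # gs" by (cases es) auto
      then have "l = k + Suc (l - k - 1)" using that by (simp add: C_def)
      then have "x 0 ^ l = x 0 ^ k * (x 0 * x 0 ^ (l - k - 1))" by (metis power_Suc power_add)
      then show ?thesis by (simp add: es kscale_def x'_def mult_ac)
    qed
    have hc: "h \<in> carrier ?R"
      unfolding h_def kscale_def
    proof (intro ideal_poly_ring_sum[OF poly_ring.oneideal] carrier_poly_ring_mult const_mem_carrier
        carrier_poly_ring_power xc mc)
      show "length (tl es) = n" if "es \<in> C" for es using that Suc.prems(5)[of es] by (simp add: C_def)
    qed simp
    have gc: "g \<in> carrier ?R"
      unfolding g_def kscale_def
    proof (intro ideal_poly_ring_sum[OF poly_ring.oneideal] carrier_poly_ring_mult const_mem_carrier mc)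
      show "length es = n" if "es \<in> B" for es using that Suc.prems(5)[of "k # es"] by (simp add: B_def)
    qed
    have "(\<Sum>es\<in>A. kscale (u es) (mval x es)) =
        (\<Sum>es\<in>(#) k ` B \<union> C. kscale (u es) (mval x es))"
    proof (rule sum.mono_neutral_right[OF Suc.prems(4)])
      show "(#) k ` B \<union> C \<subseteq> A" by (auto simp: B_def C_def)
      show "\<forall>es\<in>A - ((#) k ` B \<union> C). kscale (u es) (mval x es) = 0"
      proof
        fix es assume es: "es \<in> A - ((#) k ` B \<union> C)"
        then obtain l gs where l: "es = l # gs" using Suc.prems(5)[of es] by (cases es) auto
        then have "l < k" using es by (cases l k rule: linorder_cases) (auto simp: B_def C_def)
        then show "kscale (u es) (mval x es) = 0" using least[of l gs] es l by (simp add: kscale_def)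
      qed
    qed
    also have "\<dots> = (\<Sum>es\<in>(#) k ` B. kscale (u es) (mval x es)) + (\<Sum>es\<in>C. kscale (u es) (mval x es))"
      using finB Suc.prems(4) by (intro sum.union_disjoint) (auto simp: C_def)
    also have "(\<Sum>es\<in>(#) k ` B. kscale (u es) (mval x es)) = x 0 ^ k * g"
      by (simp add: sum.reindex g_def sum_distrib_left kscale_def x'_def mult_ac)
    also have "(\<Sum>es\<in>C. kscale (u es) (mval x es)) = x 0 ^ k * (x 0 * h)"
      unfolding h_def sum_distrib_left by (intro sum.cong refl C_term)
    finally have "(\<Sum>es\<in>A. kscale (u es) (mval x es)) = x 0 ^ k * (g + x 0 * h)"
      by (simp add: distrib_left)
    then have "x 0 ^ k * (g + x 0 * h) \<in> c 0" using Suc.prems(6) by simp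
    moreover have "x 0 ^ k \<notin> c 0"
      using primeideal_power[OF prime[of 0] xc[of 0], of k] Suc.prems(3)[of 0] by auto
    moreover have "x 0 * h \<in> carrier ?R" using hc xc by (simp add: carrier_poly_ring_mult)
    then have "g + x 0 * h \<in> carrier ?R"
      using gc ideal_poly_ring_add[OF poly_ring.oneideal] by blast
    ultimately have "g + x 0 * h \<in> c 0"
      using primeideal_prime[OF prime[of 0] carrier_poly_ring_power[OF xc[of 0], of k]] by auto
    then have gh: "g + x 0 * h \<in> c 1" using Suc.prems(2)[of 0] by auto
    have "h * x 0 \<in> c 1"
      using ideal_poly_ring_mult[OF id[of 1] hc, of "x 0"] Suc.prems(3)[of 0] by auto
    then have "g \<in> c 1"
      using ideal_poly_ring_diff[OF id[of 1] gh, of "x 0 * h"] by (simp add: mult.commute)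
    then have g': "(\<Sum>fs\<in>B. kscale (u (k # fs)) (mval x' fs)) \<in> c' 0" by (simp add: g_def c'_def)
    have "u (k # fs) = 0"
    proof (rule Suc.IH[of c' x' B "\<lambda>fs. u (k # fs)" fs])
      show "(\<Sum>fs\<in>B. kscale (u (k # fs)) (mval x' fs)) \<in> c' 0" by (rule g')
      show "primeideal (c' i) ?R" if "i \<le> n" for i using that prime by (simp add: c'_def)
      show "c' i \<subseteq> c' (Suc i)" if "i < n" for i using that Suc.prems(2) by (simp add: c'_def)
      show "x' i \<in> c' (Suc i) - c' i" if "i < n" for i using that Suc.prems(3) by (simp add: c'_def x'_def)
      show "length gs = n" if "gs \<in> B" for gs using that Suc.prems(5)[of "k # gs"] by (simp add: B_def)
    qed (use finB fs in \<open>simp_all add: B_def\<close>)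
    then show False using fs by simp
  qed
qed

text \<open>A statement about families rather than sets, because two members of the family may coincide.\<close>

lemma linear_dependence_family:
  fixes f :: "'a \<Rightarrow> 'k::field mpoly"
  assumes "finite A" "finite T" "card T < card A" "\<And>a. a \<in> A \<Longrightarrow> f a \<in> kspace.span T"
  shows "\<exists>u. (\<Sum>a\<in>A. kscale (u a) (f a)) = 0 \<and> (\<exists>a\<in>A. u a \<noteq> 0)"
proof (cases "inj_on f A")
  case True
  have "kspace.dependent (f ` A)"
  proof (rule ccontr)
    assume "kspace.independent (f ` A)"
    then have "card (f ` A) \<le> card T"
      using kspace.independent_span_bound[of T "f ` A"] assms by auto
    then show False using assms(3) card_image[OF True] by simp
  qed
  then obtain v where "(\<Sum>b\<in>f ` A. kscale (v b) b) = 0" "\<exists>b\<in>f ` A. v b \<noteq> 0"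
    using kspace.dependent_finite[of "f ` A"] assms(1) by auto
  then show ?thesis
    by (intro exI[of _ "\<lambda>a. v (f a)"]) (auto simp: sum.reindex[OF True])
next
  case False
  then obtain a b where ab: "a \<in> A" "b \<in> A" "a \<noteq> b" "f a = f b" by (auto simp: inj_on_def)
  define u where "u = (\<lambda>c. if c = a then 1 else if c = b then - 1 else (0::'k))"
  have "(\<Sum>c\<in>A. kscale (u c) (f c)) = (\<Sum>c\<in>{a, b}. kscale (u c) (f c))"
    using assms(1) ab by (intro sum.mono_neutral_right) (auto simp: u_def kscale_def)
  also have "\<dots> = 0" using ab(3,4) by (simp add: u_def kscale_def single_uminus)
  finally show ?thesis using ab(1) by (intro exI[of _ u]) (auto simp: u_def)
qed

definition expo_box :: "nat set \<Rightarrow> nat \<Rightarrow> expo set"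
  where "expo_box X b = {t. keys t \<subseteq> X \<and> (\<forall>i. lookup t i \<le> b)}"

lemma card_expo_box:
  "finite (expo_box {1..d} b) \<and> card (expo_box {1..d} b) \<le> (b + 1) ^ d"
proof -
  let ?L = "{xs. set xs \<subseteq> {..b} \<and> length xs = d}"
  define f where "f = (\<lambda>t::expo. map (lookup t) [1..<Suc d])"
  have inj: "inj_on f (expo_box {1..d} b)"
  proof (rule inj_onI, rule poly_mapping_eqI)
    fix s t i assume st: "s \<in> expo_box {1..d} b" "t \<in> expo_box {1..d} b" "f s = f t"
    show "lookup s i = lookup t i"
    proof (cases "i \<in> {1..d}")
      case True
      then show ?thesis using st(3) by (auto simp: f_def)
    next
      case False
      then have "i \<notin> keys s" "i \<notin> keys t" using st(1,2) by (auto simp: expo_box_def)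
      then show ?thesis by (simp add: in_keys_iff)
    qed
  qed
  have sub: "f ` expo_box {1..d} b \<subseteq> ?L" by (auto simp: f_def expo_box_def)
  have L: "finite ?L" "card ?L = (b + 1) ^ d"
    by (simp_all add: finite_lists_length_eq card_lists_length_eq)
  show ?thesis using inj_on_finite[OF inj sub L(1)] card_inj_on_le[OF inj sub L(1)] L(2) by simp
qed

lemma expo_box_add: "s \<in> expo_box X a \<Longrightarrow> t \<in> expo_box X b \<Longrightarrow> s + t \<in> expo_box X (a + b)"
  by (auto simp: expo_box_def keys_add_expo lookup_add add_mono)

lemma expo_box_power:
  "p \<in> mon_ideal (expo_box X b) \<Longrightarrow> p ^ k \<in> mon_ideal (expo_box X (k * b))"
proof (induction k)
  case (Suc k)
  have "p ^ k \<in> mon_ideal (expo_box X (k * b))" using Suc by simp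
  from mon_ideal_mult[OF Suc.prems this expo_box_add] show ?case by simp
qed (simp add: mon_ideal_def expo_box_def)

lemma expo_box_mval:
  "(\<And>i. i < length es \<Longrightarrow> x i \<in> mon_ideal (expo_box X b)) \<Longrightarrow>
    mval x es \<in> mon_ideal (expo_box X (sum_list es * b))"
proof (induction es arbitrary: x)
  case (Cons k es)
  have "x 0 \<in> mon_ideal (expo_box X b)" using Cons.prems[of 0] by simp
  then have "x 0 ^ k \<in> mon_ideal (expo_box X (k * b))" by (rule expo_box_power)
  moreover have "mval (\<lambda>i. x (Suc i)) es \<in> mon_ideal (expo_box X (sum_list es * b))"
    using Cons.prems by (intro Cons.IH) simp
  ultimately have "x 0 ^ k * mval (\<lambda>i. x (Suc i)) es \<in>
      mon_ideal (expo_box X (k * b + sum_list es * b))"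
    by (rule mon_ideal_mult) (rule expo_box_add)
  then show ?case by (simp add: distrib_right)
qed (simp add: mon_ideal_def expo_box_def)

text \<open>Counting: with exponents below \<open>N\<close> there are \<open>N\<^sup>d\<^sup>+\<^sup>1\<close> products of powers of the \<open>d + 1\<close>
  polynomials, but all of them lie in the span of the monomials with exponents at most \<open>e N\<close>, of
  which there are at most \<open>(e N + 1)\<^sup>d\<close>. For large \<open>N\<close> the products are linearly dependent.\<close>

lemma algebraic_dependence:
  fixes x :: "nat \<Rightarrow> 'k::field mpoly"
  assumes "\<And>i. i \<le> d \<Longrightarrow> x i \<in> carrier (poly_ring {1..d})"
  shows "\<exists>A u. finite A \<and> (\<forall>es\<in>A. length es = Suc d) \<and>
    (\<Sum>es\<in>A. kscale (u es) (mval x es)) = 0 \<and> (\<exists>es\<in>A. u es \<noteq> 0)"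
proof -
  define b where "b = (\<Sum>i\<le>d. \<Sum>t\<in>keys (x i). mdeg t)"
  have xb: "x i \<in> mon_ideal (expo_box {1..d} b)" if i: "i \<le> d" for i
  proof -
    have "lookup t j \<le> b" if t: "t \<in> keys (x i)" for t j
    proof -
      have "lookup t j \<le> mdeg t"
        using member_le_sum[of j "keys t" "lookup t"] by (cases "j \<in> keys t") (auto simp: mdeg_def in_keys_iff)
      also have "\<dots> \<le> (\<Sum>t\<in>keys (x i). mdeg t)" by (rule member_le_sum) (use t in auto)
      also have "\<dots> \<le> b" unfolding b_def by (rule member_le_sum) (use i in auto)
      finally show ?thesis .
    qed
    then show ?thesis
      using assms[OF i] by (auto simp: mon_ideal_def expo_box_def carrier_poly_ring)
  qed
  define e where "e = Suc d * b"
  \<comment> \<open>large enough for \<open>(e N + 1)\<^sup>d \<le> (e + 1)\<^sup>d N\<^sup>d < N\<^sup>d\<^sup>+\<^sup>1\<close>\<close>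
  define N where "N = Suc ((e + 1) ^ d)"
  define A where "A = {es. set es \<subseteq> {..<N} \<and> length es = Suc d}"
  define T where "T = (monomial ` expo_box {1..d} (e * N) :: 'k mpoly set)"
  have finA: "finite A" and cardA: "card A = N ^ Suc d"
    unfolding A_def by (simp_all only: finite_lists_length_eq card_lists_length_eq finite_lessThan card_lessThan)
  have finT: "finite T" using card_expo_box by (auto simp: T_def)
  have "card T \<le> card (expo_box {1..d} (e * N))"
    unfolding T_def using card_expo_box by (intro card_image_le) blast
  also have "\<dots> \<le> (e * N + 1) ^ d" using card_expo_box by blast
  also have "\<dots> \<le> ((e + 1) * N) ^ d" by (rule power_mono) (simp_all add: N_def)
  also have "\<dots> = (e + 1) ^ d * N ^ d" by (rule power_mult_distrib)
  also have "\<dots> < N * N ^ d" by (rule mult_strict_right_mono) (simp_all add: N_def)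
  finally have card: "card T < card A" by (simp add: cardA)
  have "mval x es \<in> kspace.span T" if es: "es \<in> A" for es
  proof -
    have "x \<le> N" if "x \<in> set es" for x using es that by (auto simp: A_def)
    then have "sum_list es \<le> length es * N"
      using sum_list_mono[of es "\<lambda>x. x" "\<lambda>_. N"] by (simp add: sum_list_triv)
    then have "sum_list es * b \<le> length es * N * b" by (rule mult_right_mono) simp
    also have "\<dots> = e * N" using es by (simp only: A_def e_def mem_Collect_eq mult_ac)
    finally have "sum_list es * b \<le> e * N" .
    then have "expo_box {1..d} (sum_list es * b) \<subseteq> expo_box {1..d} (e * N)"
      by (auto simp: expo_box_def intro: order_trans)
    moreover have "mval x es \<in> mon_ideal (expo_box {1..d} (sum_list es * b))"
      by (rule expo_box_mval) (use es xb in \<open>simp add: A_def\<close>)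
    ultimately have "mval x es \<in> mon_ideal (expo_box {1..d} (e * N))"
      using mon_ideal_mono by blast
    then show ?thesis unfolding T_def span_monomials[symmetric] by (simp add: Setcompr_eq_image)
  qed
  from linear_dependence_family[where f = "mval x", OF finA finT card this] obtain u where
    "(\<Sum>es\<in>A. kscale (u es) (mval x es)) = 0" "\<exists>es\<in>A. u es \<noteq> 0" by blast
  moreover have "\<forall>es\<in>A. length es = Suc d" by (simp add: A_def)
  ultimately show ?thesis using finA by blast
qed

text \<open>The polynomial ring in \<open>d\<close> variables has dimension at most \<open>d\<close>: a longer chain would provide
  \<open>d + 1\<close> algebraically independent polynomials.\<close>

lemma prime_chain_length_le:
  fixes c :: "nat \<Rightarrow> 'k::field mpoly set"
  assumes "\<And>i. i \<le> n \<Longrightarrow> primeideal (c i) (poly_ring {1..d})"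
    and "\<And>i. i < n \<Longrightarrow> c i \<subset> c (Suc i)"
  shows "n \<le> d"
proof (rule ccontr)
  assume "\<not> n \<le> d"
  then have n: "Suc d \<le> n" by simp
  define x where "x = (\<lambda>i. SOME y. y \<in> c (Suc i) - c i)"
  have x: "x i \<in> c (Suc i) - c i" if "i \<le> d" for i
  proof -
    have "c i \<subset> c (Suc i)" using that n by (intro assms(2)) simp
    then have "\<exists>y. y \<in> c (Suc i) - c i" by blast
    then show ?thesis unfolding x_def by (rule someI_ex)
  qed
  have "x i \<in> carrier (poly_ring {1..d})" if "i \<le> d" for i
  proof -
    have "primeideal (c (Suc i)) (poly_ring {1..d})" using that n by (intro assms(1)) simp
    then have "c (Suc i) \<subseteq> carrier (poly_ring {1..d})"
      by (intro ideal_poly_ring_subset primeideal_ideal)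
    then show ?thesis using x[OF that] by blast
  qed
  from algebraic_dependence[where x = x, OF this] obtain A u where "finite A \<and> (\<forall>es\<in>A. length es = Suc d) \<and>
    (\<Sum>es\<in>A. kscale (u es) (mval x es)) = 0 \<and> (\<exists>es\<in>A. u es \<noteq> 0)" by blast
  then have A: "finite A" "\<And>es. es \<in> A \<Longrightarrow> length es = Suc d"
    "(\<Sum>es\<in>A. kscale (u es) (mval x es)) = 0" "\<exists>es\<in>A. u es \<noteq> 0" by simp_all
  have "u es = 0" if "es \<in> A" for es
  proof (rule prime_chain_independent[OF _ _ _ A(1,2) _ that])
    show "(\<Sum>es\<in>A. kscale (u es) (mval x es)) \<in> c 0"
      unfolding A(3) by (rule ideal_poly_ring_0[OF primeideal_ideal[OF assms(1)]]) simp
    show "primeideal (c i) (poly_ring {1..d})" if "i \<le> Suc d" for i using assms(1) that n by simp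
    show "c i \<subseteq> c (Suc i)" if "i < Suc d" for i using assms(2)[of i] that n by (simp add: psubset_eq)
    show "x i \<in> c (Suc i) - c i" if "i < Suc d" for i using x that by simp
  qed
  then show False using A(4) by blast
qed

section \<open>Height of strongly stable ideals\<close>

text \<open>The ideal \<open>(y\<^sub>1, \<dots>, y\<^sub>k)\<close> of \<open>K[y\<^sub>1, \<dots>, y\<^sub>d]\<close>.\<close>

definition var_ideal :: "nat \<Rightarrow> nat \<Rightarrow> 'k::field mpoly set"
  where "var_ideal d k = mon_ideal {t. keys t \<subseteq> {1..d} \<and> keys t \<inter> {1..k} \<noteq> {}}"

lemma upset_var: "upset_expos {1..d} {t. keys t \<subseteq> {1..d} \<and> keys t \<inter> {1..k} \<noteq> {}}"
  by (auto simp: upset_expos_def keys_add_expo)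

lemma mon_ideal_split:
  "\<exists>q r. p = q + r \<and> (q :: 'k::field mpoly) \<in> mon_ideal (keys p \<inter> N) \<and> r \<in> mon_ideal (keys p - N)"
proof (intro exI conjI)
  let ?f = "\<lambda>t. kscale (lookup p t) (monomial t)"
  have "p = sum ?f (keys p)" by (rule poly_eq_sum_monomials)
  also have "keys p = (keys p \<inter> N) \<union> (keys p - N)" by auto
  also have "sum ?f \<dots> = sum ?f (keys p \<inter> N) + sum ?f (keys p - N)"
    by (rule sum.union_disjoint) auto
  finally show "p = sum ?f (keys p \<inter> N) + sum ?f (keys p - N)" .
  have *: "sum ?f M \<in> mon_ideal M" for M
    unfolding span_monomials[symmetric]
    by (intro kspace.span_sum kspace.span_scale kspace.span_base) auto
  show "sum ?f (keys p \<inter> N) \<in> mon_ideal (keys p \<inter> N)" by (rule *)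
  show "sum ?f (keys p - N) \<in> mon_ideal (keys p - N)" by (rule *)
qed

text \<open>Split two polynomials into their parts inside the ideal and their parts free of
  \<open>y\<^sub>1, \<dots>, y\<^sub>k\<close>. If the product lies in the ideal, so does the product of the free parts; being free of
  \<open>y\<^sub>1, \<dots>, y\<^sub>k\<close> it vanishes, and one of the two factors is zero.\<close>

lemma primeideal_var_ideal: "primeideal (var_ideal d k :: 'k::field mpoly set) (poly_ring {1..d})"
proof (rule primeidealI[OF _ cring_poly_ring])
  let ?N = "{t. keys t \<subseteq> {1..d} \<and> keys t \<inter> {1..k} \<noteq> {}}"
  show I: "ideal (var_ideal d k :: 'k mpoly set) (poly_ring {1..d})"
    unfolding var_ideal_def by (rule ideal_mon_ideal[OF upset_var])
  have "(1 :: 'k mpoly) \<notin> var_ideal d k" by (simp add: var_ideal_def mon_ideal_def)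
  then show "carrier (poly_ring {1..d}) \<noteq> (var_ideal d k :: 'k mpoly set)"
    using carrier_poly_ring_one by blast
  fix p q :: "'k mpoly"
  assume pq: "p \<in> carrier (poly_ring {1..d})" "q \<in> carrier (poly_ring {1..d})"
    "p \<otimes>\<^bsub>poly_ring {1..d}\<^esub> q \<in> var_ideal d k"
  obtain p1 p2 where p: "p = p1 + p2" "p1 \<in> mon_ideal (keys p \<inter> ?N)" "p2 \<in> mon_ideal (keys p - ?N)"
    using mon_ideal_split by blast
  obtain q1 q2 where q: "q = q1 + q2" "q1 \<in> mon_ideal (keys q \<inter> ?N)" "q2 \<in> mon_ideal (keys q - ?N)"
    using mon_ideal_split by blast
  have p1: "p1 \<in> var_ideal d k" and q1: "q1 \<in> var_ideal d k"
    using p(2) q(2) by (auto simp: var_ideal_def mon_ideal_def)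
  let ?M = "{t. keys t \<subseteq> {1..d} \<and> keys t \<inter> {1..k} = {}}"
  have p2: "p2 \<in> mon_ideal ?M" and q2: "q2 \<in> mon_ideal ?M"
    using p(3) q(3) pq(1,2) unfolding carrier_poly_ring mon_ideal_def by blast+
  have "p2 \<in> carrier (poly_ring {1..d})"
    using p2 by (auto simp: carrier_poly_ring mon_ideal_def)
  then have "p2 * q1 \<in> var_ideal d k" "q * p1 \<in> var_ideal d k"
    using pq(2) p1 q1 ideal_poly_ring_mult[OF I] by auto
  then have "p * q - (q * p1 + p2 * q1) \<in> var_ideal d k"
    using pq(3) by (intro ideal_poly_ring_diff[OF I] ideal_poly_ring_add[OF I]) simp_all
  moreover have "p * q - (q * p1 + p2 * q1) = p2 * q2" by (simp add: p(1) q(1) algebra_simps)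
  ultimately have "p2 * q2 \<in> var_ideal d k" by simp
  moreover have "p2 * q2 \<in> mon_ideal ?M"
    by (rule mon_ideal_mult[OF p2 q2]) (auto simp: keys_add_expo)
  ultimately have "keys (p2 * q2) = {}" unfolding var_ideal_def mon_ideal_def by blast
  then have "p2 * q2 = 0" by simp
  then have "p2 = 0 \<or> q2 = 0" by simp
  then show "p \<in> var_ideal d k \<or> q \<in> var_ideal d k" using p1 q1 p(1) q(1) by auto
qed

lemma var_ideal_strict_mono:
  assumes "k < d"
  shows "(var_ideal d k :: 'k::field mpoly set) \<subset> var_ideal d (Suc k)"
proof
  show "(var_ideal d k :: 'k mpoly set) \<subseteq> var_ideal d (Suc k)"
    unfolding var_ideal_def by (rule mon_ideal_mono) force
  have "(monomial (single (Suc k) 1) :: 'k mpoly) \<in> var_ideal d (Suc k)"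
    "(monomial (single (Suc k) 1) :: 'k mpoly) \<notin> var_ideal d k"
    using assms by (simp_all add: var_ideal_def)
  then show "(var_ideal d k :: 'k mpoly set) \<noteq> var_ideal d (Suc k)" by blast
qed

lemma prime_height_var_ideal:
  "prime_height (poly_ring {1..d} :: 'k::field mpoly ring) (var_ideal d d) = enat d"
  unfolding prime_height_def
proof (rule antisym)
  show "Sup {enat n |n. \<exists>c. (\<forall>i\<le>n. primeideal (c i) (poly_ring {1..d})) \<and> (\<forall>i<n. c i \<subset> c (Suc i)) \<and>
      c n = (var_ideal d d :: 'k mpoly set)} \<le> enat d"
  proof (rule Sup_least, safe)
    fix n and c :: "nat \<Rightarrow> 'k mpoly set"
    assume "\<forall>i\<le>n. primeideal (c i) (poly_ring {1..d})" "\<forall>i<n. c i \<subset> c (Suc i)"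
    then have "n \<le> d" by (intro prime_chain_length_le[of n c d]) blast+
    then show "enat n \<le> enat d" by simp
  qed
  show "enat d \<le> Sup {enat n |n. \<exists>c. (\<forall>i\<le>n. primeideal (c i) (poly_ring {1..d})) \<and> (\<forall>i<n. c i \<subset> c (Suc i)) \<and>
      c n = (var_ideal d d :: 'k mpoly set)}"
    by (rule Sup_upper, intro CollectI exI[of _ d] exI[of _ "var_ideal d"])
      (use primeideal_var_ideal var_ideal_strict_mono in blast)
qed

text \<open>A chain ending in \<open>(y\<^sub>1, \<dots>, y\<^sub>d\<^sub>-\<^sub>1)\<close> can be prolonged by \<open>(y\<^sub>1, \<dots>, y\<^sub>d)\<close>.\<close>

lemma prime_height_var_ideal_less:
  assumes "1 \<le> d"
  shows "prime_height (poly_ring {1..d} :: 'k::field mpoly ring) (var_ideal d (d - 1)) < enat d"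
proof -
  have len: "Suc n \<le> d" if c: "\<forall>i\<le>n. primeideal (c i) (poly_ring {1..d})" "\<forall>i<n. c i \<subset> c (Suc i)"
    "c n = (var_ideal d (d - 1) :: 'k mpoly set)" for n c
  proof -
    define c' where "c' = (\<lambda>i. if i \<le> n then c i else var_ideal d d)"
    show ?thesis
    proof (rule prime_chain_length_le)
      fix i
      show "primeideal (c' i) (poly_ring {1..d})"
        using c(1) primeideal_var_ideal[of d d, where ?'k = 'k] by (cases "i \<le> n") (simp_all add: c'_def)
      assume "i < Suc n"
      then show "c' i \<subset> c' (Suc i)"
        using c(2,3) var_ideal_strict_mono[of "d - 1" d, where ?'k = 'k] assms
        by (cases "i = n") (simp_all add: c'_def)
    qed
  qed
  have "prime_height (poly_ring {1..d} :: 'k mpoly ring) (var_ideal d (d - 1)) \<le> enat (d - 1)"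
    unfolding prime_height_def
  proof (rule Sup_least, safe)
    fix n and c :: "nat \<Rightarrow> 'k mpoly set"
    assume "\<forall>i\<le>n. primeideal (c i) (poly_ring {1..d})" "\<forall>i<n. c i \<subset> c (Suc i)"
      "c n = var_ideal d (d - 1)"
    from len[OF this] show "enat n \<le> enat (d - 1)" by simp
  qed
  also have "\<dots> < enat d" using assms by simp
  finally show ?thesis .
qed

text \<open>The ideal of all variables is maximal: modulo it every polynomial is a constant, and a prime
  ideal contains no nonzero constant.\<close>

lemma primeideal_eq_var_ideal:
  assumes P: "primeideal (P :: 'k::field mpoly set) (poly_ring {1..d})"
    and vars: "\<And>i. i \<in> {1..d} \<Longrightarrow> monomial (single i 1) \<in> P"
  shows "P = var_ideal d d"
proof
  note I = primeideal_ideal[OF P]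
  let ?N = "{t. keys t \<subseteq> {1..d} \<and> keys t \<inter> {1..d} \<noteq> {}}"
  have mon: "monomial t \<in> P" if t: "t \<in> ?N" for t
  proof -
    obtain i where i: "i \<in> keys t" "i \<in> {1..d}" using t by blast
    define s where "s = t - single i 1"
    have ts: "t = s + single i 1" unfolding s_def
      by (rule expo_split_var) (use i(1) in \<open>simp add: in_keys_iff\<close>)
    have "(monomial s :: 'k mpoly) \<in> carrier (poly_ring {1..d})"
      using t by (simp add: carrier_poly_ring ts keys_add_expo)
    then have "monomial s * monomial (single i 1) \<in> P"
      by (rule ideal_poly_ring_mult[OF I]) (rule vars[OF i(2)])
    then show ?thesis unfolding ts monomial_mult .
  qed
  show sub: "var_ideal d d \<subseteq> P"
  proof
    fix p :: "'k mpoly" assume p: "p \<in> var_ideal d d"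
    have "(\<Sum>t\<in>keys p. kscale (lookup p t) (monomial t)) \<in> P"
      unfolding kscale_def
      by (intro ideal_poly_ring_sum[OF I] ideal_poly_ring_mult[OF I] mon const_mem_carrier)
        (use p in \<open>auto simp: mon_ideal_def var_ideal_def\<close>)
    then show "p \<in> P" by (simp only: poly_eq_sum_monomials[of p, symmetric])
  qed
  show "P \<subseteq> var_ideal d d"
  proof
    fix p assume p: "p \<in> P"
    then have pc: "keys p \<subseteq> {t. keys t \<subseteq> {1..d}}"
      using ideal_poly_ring_subset[OF I] by (auto simp: carrier_poly_ring mon_ideal_def)
    obtain q r where qr: "p = q + r" "q \<in> mon_ideal (keys p \<inter> ?N)" "r \<in> mon_ideal (keys p - ?N)"
      using mon_ideal_split by blast
    have q: "q \<in> var_ideal d d" using qr(2) by (auto simp: var_ideal_def mon_ideal_def)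
    have "t = 0" if "t \<in> keys r" for t
    proof -
      have "keys t = {}" using that qr(3) pc unfolding mon_ideal_def by blast
      then show ?thesis by simp
    qed
    then have "r = single 0 (lookup r 0)"
      by (intro poly_mapping_eqI) (auto simp: lookup_single when_def in_keys_iff)
    moreover have "r \<in> P" using ideal_poly_ring_diff[OF I p, of q] q sub qr(1) by auto
    ultimately have "lookup r 0 = 0" using primeideal_const[OF P] by metis
    with \<open>r = single 0 (lookup r 0)\<close> have "r = 0" by simp
    then show "p \<in> var_ideal d d" using q qr(1) by simp
  qed
qed

lemma monomial_power: "monomial (single i n) = (monomial (single i 1) :: 'k::field mpoly) ^ n"
proof (induction n)
  case 0
  then show ?case by (simp add: monomial_def)
next
  case (Suc n)
  have "single i (Suc n) = single i 1 + single i n" by (simp flip: single_add)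
  then show ?case by (simp only: monomial_mult Suc power_Suc)
qed

text \<open>A set of monomials without powers of \<open>y\<^sub>d\<close> lies in \<open>(y\<^sub>1, \<dots>, y\<^sub>d\<^sub>-\<^sub>1)\<close>, which has height below
  \<open>d\<close>. Conversely \<open>y\<^sub>d\<^sup>n\<close> yields all \<open>y\<^sub>i\<^sup>n\<close> by strong stability, so a prime above the ideal contains
  all variables and is the maximal ideal \<open>(y\<^sub>1, \<dots>, y\<^sub>d)\<close> of height \<open>d\<close>.\<close>

lemma ideal_height_eq_iff:
  assumes N: "upset_expos {1..d} N" "stable_expos {1..d} N" and d: "1 \<le> d"
  shows "ideal_height (poly_ring {1..d}) (mon_ideal N :: 'k::field mpoly set) = enat d \<longleftrightarrow>
    0 \<notin> N \<and> (\<exists>n. single d n \<in> N)"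
proof
  let ?R = "poly_ring {1..d} :: 'k mpoly ring"
  have kN: "keys t \<subseteq> {1..d}" if "t \<in> N" for t using N(1) that by (auto simp: upset_expos_def)
  {
    assume ht: "ideal_height ?R (mon_ideal N) = enat d"
    have "0 \<notin> N"
    proof
      assume "0 \<in> N"
      then have one: "single 0 1 \<in> (mon_ideal N :: 'k mpoly set)" by (simp add: mon_ideal_def)
      have no: "\<not> (primeideal P ?R \<and> mon_ideal N \<subseteq> P)" for P
        using primeideal_const[of P "{1..d}" 1] one by auto
      have "ideal_height ?R (mon_ideal N) = Inf {}"
        unfolding ideal_height_def by (rule arg_cong[where f = Inf]) (use no in blast)
      then show False using ht by (simp add: top_enat_def)
    qed
    moreover have "\<exists>n. single d n \<in> N"
    proof (rule ccontr)
      assume no: "\<not> (\<exists>n. single d n \<in> N)"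
      have "N \<subseteq> {t. keys t \<subseteq> {1..d} \<and> keys t \<inter> {1..d - 1} \<noteq> {}}"
      proof safe
        fix t assume t: "t \<in> N" and em: "keys t \<inter> {1..d - 1} = {}"
        have "keys t \<subseteq> {d}"
        proof
          fix i assume "i \<in> keys t"
          then have "i \<in> {1..d}" "i \<notin> {1..d - 1}" using kN[OF t] em by auto
          then show "i \<in> {d}" by auto
        qed
        then have "t = single d (lookup t d)"
          by (intro poly_mapping_eqI) (auto simp: lookup_single when_def in_keys_iff)
        then show False using no t by metis
      qed (use kN in blast)
      then have "mon_ideal N \<subseteq> (var_ideal d (d - 1) :: 'k mpoly set)"
        unfolding var_ideal_def by (rule mon_ideal_mono)
      then have "ideal_height ?R (mon_ideal N) \<le> prime_height ?R (var_ideal d (d - 1))"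
        unfolding ideal_height_def using primeideal_var_ideal by (intro Inf_lower) blast
      also have "\<dots> < enat d" by (rule prime_height_var_ideal_less[OF d])
      finally show False using ht by simp
    qed
    ultimately show "0 \<notin> N \<and> (\<exists>n. single d n \<in> N)" by blast
  }
  assume R: "0 \<notin> N \<and> (\<exists>n. single d n \<in> N)"
  then obtain n where n: "single d n \<in> N" by blast
  have pow: "single i n \<in> N" if i: "i \<in> {1..d}" for i
    by (rule stable_upset_dominance[OF N n _ d]) (use i in \<open>auto simp: psum_single\<close>)
  have uniq: "P = var_ideal d d" if P: "primeideal P ?R" "mon_ideal N \<subseteq> P" for P
  proof (rule primeideal_eq_var_ideal[OF P(1)])
    fix i assume i: "i \<in> {1..d}"
    have "monomial (single i n) \<in> P" using pow[OF i] P(2) by auto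
    then have "(monomial (single i 1) :: 'k mpoly) ^ n \<in> P" by (simp only: monomial_power[of i n])
    then show "monomial (single i 1) \<in> P"
      by (rule primeideal_power[OF P(1), rotated]) (use i in \<open>simp add: carrier_poly_ring\<close>)
  qed
  have "N \<subseteq> {t. keys t \<subseteq> {1..d} \<and> keys t \<inter> {1..d} \<noteq> {}}"
  proof safe
    fix t assume t: "t \<in> N" and "keys t \<inter> {1..d} = {}"
    then have "keys t = {}" using kN[OF t] by blast
    then show False using t R by simp
  qed (use kN in blast)
  then have "mon_ideal N \<subseteq> (var_ideal d d :: 'k mpoly set)"
    unfolding var_ideal_def by (rule mon_ideal_mono)
  then have "{prime_height ?R P | P. primeideal P ?R \<and> mon_ideal N \<subseteq> P} = {prime_height ?R (var_ideal d d)}"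
    using uniq primeideal_var_ideal by blast
  then show "ideal_height ?R (mon_ideal N) = enat d"
    unfolding ideal_height_def by (simp only: cInf_singleton prime_height_var_ideal)
qed

section \<open>The correspondence of ideals\<close>

lemma bij_betw_mon_ideal:
  assumes "1 \<le> d"
  shows "bij_betw mon_ideal (expos_B m d) (ideals_B m d :: 'k::field mpoly set set)"
  unfolding bij_betw_def
proof
  show "inj_on (mon_ideal :: _ \<Rightarrow> 'k mpoly set) (expos_B m d)"
    by (rule inj_onI) (simp add: mon_ideal_eq_iff)
  have "mon_ideal N \<in> (ideals_B m d :: 'k mpoly set set) \<longleftrightarrow> N \<in> expos_B m d"
    if N: "upset_expos {1..d} N" for N
  proof -
    have 1: "monomial_ideal {1..d} (mon_ideal N :: 'k mpoly set)"
      using N by (auto simp: monomial_ideal_iff)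
    have 2: "strongly_stable {1..d} (mon_ideal N :: 'k mpoly set) \<longleftrightarrow> stable_expos {1..d} N"
      by (simp add: strongly_stable_iff)
    have 3: "generated_in_degrees {1..d} {..m + 1} (mon_ideal N :: 'k mpoly set) \<longleftrightarrow>
        (\<forall>t\<in>N. \<exists>s\<in>N. \<exists>r. mdeg s \<le> m + 1 \<and> t = s + r)"
      by (simp only: generated_in_degrees_mon_ideal_iff[OF N] atMost_iff)
    show ?thesis
      unfolding ideals_B_def expos_B_def mem_Collect_eq 2 3
      using 1 N ideal_height_eq_iff[OF N _ assms, where ?'k = 'k] by blast
  qed
  moreover have "upset_expos {1..d} N" if "N \<in> expos_B m d" for N using that by (simp add: expos_B_def)
  moreover have "\<exists>N. upset_expos {1..d} N \<and> J = mon_ideal N" if "J \<in> (ideals_B m d :: 'k mpoly set set)" for J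
    using that by (simp add: ideals_B_def monomial_ideal_iff)
  ultimately show "mon_ideal ` expos_B m d = (ideals_B m d :: 'k mpoly set set)" by blast
qed

definition multiples :: "nat set \<Rightarrow> expo set \<Rightarrow> expo set"
  where "multiples X U = {t. keys t \<subseteq> X \<and> (\<exists>s\<in>U. \<exists>r. t = s + r)}"

lemma upset_multiples: "upset_expos X (multiples X U)"
  unfolding upset_expos_def multiples_def by (auto simp: keys_add_expo) (metis add.assoc)

text \<open>A variable dividing a multiple \<open>s + r\<close> divides \<open>s\<close> or \<open>r\<close>, and can be replaced there.\<close>

lemma stable_multiples:
  assumes "stable_expos X U"
  shows "stable_expos X (multiples X U)"
  unfolding stable_expos_def
proof safe
  fix t i j assume t: "t \<in> multiples X U" and ij: "i \<in> X" "j \<in> X" "lookup t j > 0" "i < j"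
  obtain s r where sr: "s \<in> U" "t = s + r" and kt: "keys t \<subseteq> X" using t by (auto simp: multiples_def)
  have "keys (t - single j 1 + single i 1) \<subseteq> X" using keys_move[of t j i] kt ij by blast
  moreover have "\<exists>s'\<in>U. \<exists>r'. t - single j 1 + single i 1 = s' + r'"
  proof (cases "lookup s j > 0")
    case True
    then have "s - single j 1 + single i 1 \<in> U" using assms sr(1) ij by (simp add: stable_expos_def)
    moreover have "t - single j 1 + single i 1 = (s - single j 1 + single i 1) + r"
      using True by (intro poly_mapping_eqI) (auto simp: sr(2) lookup_add lookup_minus lookup_single when_def)
    ultimately show ?thesis by blast
  next
    case False
    then have "t - single j 1 + single i 1 = s + (r - single j 1 + single i 1)"
      by (intro poly_mapping_eqI) (auto simp: sr(2) lookup_add lookup_minus lookup_single when_def)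
    then show ?thesis using sr(1) by blast
  qed
  ultimately show "t - single j 1 + single i 1 \<in> multiples X U" by (simp add: multiples_def)
qed

lemma mdeg_part_multiples:
  assumes "U \<subseteq> {t. keys t \<subseteq> X \<and> mdeg t = d}"
  shows "{t \<in> multiples X U. mdeg t = d} = U"
proof safe
  fix t assume t: "t \<in> multiples X U" "d = mdeg t"
  then obtain s r where sr: "s \<in> U" "t = s + r" by (auto simp: multiples_def)
  then have "mdeg r = 0" using assms t(2) by (auto simp: mdeg_add)
  then show "t \<in> U" using sr by (simp add: mdeg_eq_0_iff)
next
  fix t assume "t \<in> U"
  then show "t \<in> multiples X U" "mdeg t = d"
    using assms by (auto simp: multiples_def intro!: bexI[of _ t] exI[of _ 0])
qed

definition degree_part :: "nat \<Rightarrow> 'k::field mpoly set \<Rightarrow> expo set"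
  where "degree_part d I = {t. mdeg t = d \<and> monomial t \<in> I}"

lemma degree_part_mon_ideal: "degree_part d (mon_ideal N :: 'k::field mpoly set) = {t\<in>N. mdeg t = d}"
  by (auto simp: degree_part_def)

text \<open>An ideal generated in degree \<open>d\<close> is recovered from its degree \<open>d\<close> part as the ideal of all
  multiples.\<close>

lemma bij_betw_degree_part:
  "bij_betw (degree_part d) (ideals_A m d :: 'k::field mpoly set set) (expos_A m d)"
proof (rule bij_betw_byWitness[where f' = "\<lambda>U. mon_ideal (multiples {0..m} U)"])
  let ?X = "{0..m}"
  have A: "\<exists>N. I = mon_ideal N \<and> upset_expos ?X N \<and> stable_expos ?X N \<and> N \<noteq> {} \<and>
      (\<forall>t\<in>N. \<exists>s\<in>N. \<exists>r. mdeg s = d \<and> t = s + r)" if I: "I \<in> ideals_A m d" for I :: "'k mpoly set"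
  proof -
    obtain N where N: "upset_expos ?X N" "I = mon_ideal N"
      using I by (auto simp: ideals_A_def monomial_ideal_iff)
    moreover have "stable_expos ?X N" using I N by (simp add: ideals_A_def strongly_stable_iff)
    moreover have "N \<noteq> {}" using I N by (auto simp: ideals_A_def mon_ideal_def)
    moreover have "\<forall>t\<in>N. \<exists>s\<in>N. \<exists>r. mdeg s = d \<and> t = s + r"
      using I N generated_in_degrees_mon_ideal_iff[OF N(1), of "{d}", where ?'k = 'k]
      by (simp add: ideals_A_def)
    ultimately show ?thesis by blast
  qed
  show "\<forall>I\<in>ideals_A m d. mon_ideal (multiples ?X (degree_part d I)) = (I :: 'k mpoly set)"
  proof
    fix I :: "'k mpoly set" assume "I \<in> ideals_A m d"
    from A[OF this] obtain N where N: "I = mon_ideal N" "upset_expos ?X N"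
      "\<forall>t\<in>N. \<exists>s\<in>N. \<exists>r. mdeg s = d \<and> t = s + r" by blast
    have "multiples ?X {t\<in>N. mdeg t = d} = N"
    proof
      show "multiples ?X {t\<in>N. mdeg t = d} \<subseteq> N"
        using N(2) by (auto simp: multiples_def upset_expos_def keys_add_expo)
      show "N \<subseteq> multiples ?X {t\<in>N. mdeg t = d}"
        using N(2,3) unfolding multiples_def upset_expos_def by blast
    qed
    then show "mon_ideal (multiples ?X (degree_part d I)) = I"
      unfolding N(1) degree_part_mon_ideal by simp
  qed
  show "\<forall>U\<in>expos_A m d. degree_part d (mon_ideal (multiples ?X U) :: 'k mpoly set) = U"
    unfolding degree_part_mon_ideal
  proof
    fix U assume "U \<in> expos_A m d"
    then have "U \<subseteq> {t. keys t \<subseteq> ?X \<and> mdeg t = d}" by (auto simp: expos_A_def)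
    then show "{t \<in> multiples ?X U. mdeg t = d} = U" by (rule mdeg_part_multiples)
  qed
  show "degree_part d ` (ideals_A m d :: 'k mpoly set set) \<subseteq> expos_A m d"
  proof safe
    fix I :: "'k mpoly set" assume "I \<in> ideals_A m d"
    from A[OF this] obtain N where N: "I = mon_ideal N" "upset_expos ?X N" "stable_expos ?X N" "N \<noteq> {}"
      "\<forall>t\<in>N. \<exists>s\<in>N. \<exists>r. mdeg s = d \<and> t = s + r" by blast
    have "stable_expos ?X {t\<in>N. mdeg t = d}"
      using N(3) mdeg_move unfolding stable_expos_def by auto
    moreover have "{t\<in>N. mdeg t = d} \<noteq> {}" using N(4,5) by blast
    moreover have "N \<subseteq> {t. keys t \<subseteq> ?X}" using N(2) by (simp add: upset_expos_def)
    ultimately show "degree_part d I \<in> expos_A m d"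
      unfolding N(1) degree_part_mon_ideal expos_A_def by blast
  qed
  show "(\<lambda>U. mon_ideal (multiples ?X U) :: 'k mpoly set) ` expos_A m d \<subseteq> ideals_A m d"
  proof safe
    fix U assume "U \<in> expos_A m d"
    then have U: "U \<subseteq> {t. keys t \<subseteq> ?X \<and> mdeg t = d}" "stable_expos ?X U" "U \<noteq> {}"
      by (auto simp: expos_A_def)
    let ?N = "multiples ?X U"
    have UN: "U \<subseteq> ?N" using mdeg_part_multiples[OF U(1)] by blast
    have "monomial_ideal ?X (mon_ideal ?N :: 'k mpoly set)"
      using upset_multiples by (auto simp: monomial_ideal_iff)
    moreover have "strongly_stable ?X (mon_ideal ?N :: 'k mpoly set)"
      using stable_multiples[OF U(2)] by (simp add: strongly_stable_iff)
    moreover have "(mon_ideal ?N :: 'k mpoly set) \<noteq> {0}"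
    proof
      assume zero: "(mon_ideal ?N :: 'k mpoly set) = {0}"
      obtain t where "t \<in> U" using U(3) by blast
      then have "(monomial t :: 'k mpoly) \<in> mon_ideal ?N" using UN by auto
      then have "(monomial t :: 'k mpoly) = 0" using zero by blast
      then have "lookup (monomial t :: 'k mpoly) t = 0" by simp
      then show False by (simp add: monomial_def)
    qed
    moreover have "generated_in_degrees ?X {d} (mon_ideal ?N :: 'k mpoly set)"
      unfolding generated_in_degrees_mon_ideal_iff[OF upset_multiples]
    proof
      fix t assume "t \<in> ?N"
      then obtain s r where "s \<in> U" "t = s + r" by (auto simp: multiples_def)
      then show "\<exists>s\<in>?N. \<exists>r. mdeg s \<in> {d} \<and> t = s + r" using UN U(1) by blast
    qed
    ultimately show "(mon_ideal ?N :: 'k mpoly set) \<in> ideals_A m d" by (simp add: ideals_A_def)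
  qed
qed

lemma psi_image_monomial_compl:
  assumes "1 \<le> d"
  shows "psi ` monomial_compl d (degree_space d I) =
    (mon_ideal (psi_compl d (degree_part d I)) :: 'k::field mpoly set)"
proof -
  have "degree_space d I = mon_ideal (degree_part d I)"
    unfolding degree_space_def degree_part_def span_monomials[symmetric] by simp
  then have "monomial_compl d (degree_space d I) =
      kspace.span {monomial t | t. t \<in> {t. mdeg t = d \<and> t \<notin> degree_part d I}}"
    by (simp add: monomial_compl_def)
  also have "\<dots> = mon_ideal {t. mdeg t = d \<and> t \<notin> degree_part d I}" by (rule span_monomials)
  finally have eq: "monomial_compl d (degree_space d I) = mon_ideal {t. mdeg t = d \<and> t \<notin> degree_part d I}" .
  have "inj_on psi_expo {t. mdeg t = d \<and> t \<notin> degree_part d I}"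
    by (rule inj_on_subset[OF bij_betw_imp_inj_on[OF bij_betw_psi_expo[OF assms]]]) blast
  then show ?thesis unfolding eq psi_compl_def by (rule psi_image_mon_ideal)
qed

theorem corollary2p13:
  fixes m d :: nat
  assumes "d \<ge> 1" and "m \<ge> 1"
  shows "bij_betw (\<lambda>I. psi ` monomial_compl d (degree_space d I))
           (ideals_A m d :: 'k::field mpoly set set) (ideals_B m d)"
proof -
  have "bij_betw (mon_ideal \<circ> (psi_compl d \<circ> degree_part d))
      (ideals_A m d :: 'k mpoly set set) (ideals_B m d :: 'k mpoly set set)"
    by (intro bij_betw_trans[OF bij_betw_trans[OF bij_betw_degree_part bij_betw_psi_compl]]
        bij_betw_mon_ideal assms)
  also have "mon_ideal \<circ> (psi_compl d \<circ> degree_part d) =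
      (\<lambda>I :: 'k mpoly set. psi ` monomial_compl d (degree_space d I))"
    by (rule ext) (simp add: psi_image_monomial_compl[OF assms(1)])
  finally show ?thesis .
qed

end
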